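(* Let $\varphi$ be a non surjective symbol for $S(\mathbb{R})$. Assume that $C_{\varphi}:C^{\infty}(\mathbb{R})\to C^{\infty}(\mathbb{R})$, $f\mapsto f\circ\varphi$, has closed range and that there exists a closed unbounded interval $I\subset\mathbb{R}$ such that the multiplication operator $M_{\varphi'}:S(I)\to S(I)$, $f\mapsto \varphi' f$, is well defined and has closed range. Then $C_{\varphi}:S(\mathbb{R})\to S(\mathbb{R})$, $f\mapsto f\circ\varphi$, also has closed range.
   Context: All functions are real-valued. $C^{\infty}(\mathbb{R})$ is the Fréchet space of smooth functions $\mathbb{R}\to\mathbb{R}$ with the topology of uniform convergence of all derivatives on compact sets. For $I=\mathbb{R}$ or $I\subset\mathbb{R}$ a closed unbounded interval (such as $[a,+\infty)$ or $(-\infty,a]$), $S(I)$ is the space of functions $f\in C^\infty(I)$ (with one-sided derivatives at a finite endpoint) such that $\sup_{x\in I}\sup_{0\leq j\leq n}(1+x^2)^n|f^{(j)}(x)|<\infty$ for each $n\in\mathbb{N}$, endowed with the Fréchet topology generated by these seminorms; $S(\mathbb{R})$ is the (real) Schwartz space. A function $\varphi\in C^\infty(\mathbb{R})$ is called a symbol for $S(\mathbb{R})$ if $f\circ\varphi\in S(\mathbb{R})$ whenever $f\in S(\mathbb{R})$. In $M_{\varphi'}:S(I)\to S(I)$ the function $\varphi'$ is restricted to $I$, and "well defined" means $\varphi' f\in S(I)$ for every $f\in S(I)$. An operator has closed range if its image is a closed subset of the target space. *)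

theory Defs
  imports "HOL-Analysis.Analysis"
begin

text \<open>Iterated derivatives relative to \<open>I\<close>: two-sided at interior points of \<open>I\<close>, one-sided at a
  finite endpoint. Only the values at points of \<open>I\<close> are meaningful.\<close>

definition nderiv_within :: "real set \<Rightarrow> nat \<Rightarrow> (real \<Rightarrow> real) \<Rightarrow> real \<Rightarrow> real" where
  "nderiv_within I n f = ((\<lambda>g x. vector_derivative g (at x within I)) ^^ n) f"

definition smooth_on :: "real set \<Rightarrow> (real \<Rightarrow> real) \<Rightarrow> bool" where
  "smooth_on I f \<longleftrightarrow> (\<forall>n. nderiv_within I n f differentiable_on I)"

text \<open>The locally convex topology on a function space \<open>X\<close> given by a set \<open>P\<close> of seminorms.\<close>

definition seminorm_topology ::
    "(real \<Rightarrow> real) set \<Rightarrow> ((real \<Rightarrow> real) \<Rightarrow> real) set \<Rightarrow> (real \<Rightarrow> real) topology" where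
  "seminorm_topology X P = topology_generated_by
     {{g \<in> X. p (\<lambda>x. g x - f x) < e} | f p e. f \<in> X \<and> p \<in> P \<and> e > 0}"

definition Cinf :: "(real \<Rightarrow> real) set" where
  "Cinf = {f. smooth_on UNIV f}"

definition Cinf_seminorm :: "real set \<Rightarrow> nat \<Rightarrow> (real \<Rightarrow> real) \<Rightarrow> real" where
  "Cinf_seminorm K j f = (SUP x\<in>K. \<bar>nderiv_within UNIV j f x\<bar>)"

text \<open>The empty compact set is left out because the supremum of the empty set of reals is
  unspecified.\<close>

definition Cinf_topology :: "(real \<Rightarrow> real) topology" where
  "Cinf_topology = seminorm_topology Cinf {Cinf_seminorm K j | K j. compact K \<and> K \<noteq> {}}"

definition closed_unbounded_interval :: "real set \<Rightarrow> bool" where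
  "closed_unbounded_interval I \<longleftrightarrow> is_interval I \<and> closed I \<and> \<not> bounded I"

definition schwartz_weight :: "nat \<Rightarrow> real set \<Rightarrow> (real \<Rightarrow> real) \<Rightarrow> real \<times> nat \<Rightarrow> real" where
  "schwartz_weight n I f = (\<lambda>(x, j). (1 + x\<^sup>2) ^ n * \<bar>nderiv_within I j f x\<bar>)"

text \<open>A function on \<open>I\<close> is represented by its extension to the whole line that takes the
  value \<open>undefined\<close> off \<open>I\<close>, so that equality in \<open>schwartz I\<close> is equality on \<open>I\<close>;
  for \<open>I = UNIV\<close> the condition is void.\<close>

definition schwartz :: "real set \<Rightarrow> (real \<Rightarrow> real) set" where
  "schwartz I = {f \<in> extensional I. smooth_on I f \<and>
     (\<forall>n. bdd_above (schwartz_weight n I f ` (I \<times> {0..n})))}"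

definition schwartz_seminorm :: "real set \<Rightarrow> nat \<Rightarrow> (real \<Rightarrow> real) \<Rightarrow> real" where
  "schwartz_seminorm I n f = Sup (schwartz_weight n I f ` (I \<times> {0..n}))"

definition schwartz_topology :: "real set \<Rightarrow> (real \<Rightarrow> real) topology" where
  "schwartz_topology I = seminorm_topology (schwartz I) (range (schwartz_seminorm I))"

definition schwartz_symbol :: "(real \<Rightarrow> real) \<Rightarrow> bool" where
  "schwartz_symbol \<phi> \<longleftrightarrow> \<phi> \<in> Cinf \<and> (\<forall>f\<in>schwartz UNIV. f \<circ> \<phi> \<in> schwartz UNIV)"

definition comp_op :: "(real \<Rightarrow> real) \<Rightarrow> (real \<Rightarrow> real) \<Rightarrow> real \<Rightarrow> real" where
  "comp_op \<phi> f = f \<circ> \<phi>"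

definition mult_op :: "real set \<Rightarrow> (real \<Rightarrow> real) \<Rightarrow> (real \<Rightarrow> real) \<Rightarrow> real \<Rightarrow> real" where
  "mult_op I h f = restrict (\<lambda>x. h x * f x) I"

lemma nderiv_within_zero:
  assumes "closed_unbounded_interval I" "x \<in> I"
  shows "nderiv_within I n (\<lambda>x. 0) x = 0"
proof -
  have "nderiv_within I n (\<lambda>x. 0) y = 0" if "y \<in> I" for y
    using that
  proof (induction n arbitrary: y)
    case 0
    then show ?case by (simp add: nderiv_within_def)
  next
    case (Suc n)
    have nb: "at y within I \<noteq> bot"
    proof -
      have "connected I" "\<And>z. I \<noteq> {z}"
        using assms(1) by (auto simp: closed_unbounded_interval_def is_interval_connected)
      then show ?thesis
        using connected_imp_perfect[of I y] Suc.prems by (simp add: trivial_limit_within)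
    qed
    have "((\<lambda>_. 0) has_vector_derivative (0::real)) (at y within I)" by simp
    then have "(nderiv_within I n (\<lambda>x. 0) has_vector_derivative 0) (at y within I)"
      by (rule has_vector_derivative_transform[OF Suc.prems, rotated]) (use Suc.IH in auto)
    then show ?case
      using nb by (simp add: nderiv_within_def vector_derivative_within)
  qed
  then show ?thesis using assms(2) by blast
qed

lemma closed_unbounded_interval_UNIV: "closed_unbounded_interval UNIV"
  by (simp add: closed_unbounded_interval_def not_bounded_UNIV)

lemma topspace_seminorm_topology:
  assumes "P \<noteq> {}" "\<And>p. p \<in> P \<Longrightarrow> p (\<lambda>x. 0) = 0"
  shows "topspace (seminorm_topology X P) = X"
proof -
  obtain p where p: "p \<in> P" using assms(1) by blast
  let ?B = "{{g \<in> X. p (\<lambda>x. g x - f x) < e} | f p e. f \<in> X \<and> p \<in> P \<and> e > 0}"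
  have "f \<in> \<Union> ?B" if "f \<in> X" for f
  proof (rule UnionI)
    show "{g \<in> X. p (\<lambda>x. g x - f x) < 1} \<in> ?B"
      by (rule CollectI, intro exI[of _ f] exI[of _ p] exI[of _ "1::real"]) (simp add: p that)
    show "f \<in> {g \<in> X. p (\<lambda>x. g x - f x) < 1}"
      using that assms(2)[OF p] by simp
  qed
  moreover have "f \<in> X" if "f \<in> \<Union> ?B" for f
    using that by auto
  ultimately have "\<Union> ?B = X" by (intro subset_antisym subsetI)
  then show ?thesis
    by (simp only: seminorm_topology_def topology_generated_by_topspace)
qed

lemma topspace_Cinf: "topspace Cinf_topology = Cinf"
  unfolding Cinf_topology_def
proof (rule topspace_seminorm_topology)
  show "{Cinf_seminorm K j | K j. compact K \<and> K \<noteq> {}} \<noteq> {}"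
    using compact_sing[of "0::real"] by blast
next
  fix p assume "p \<in> {Cinf_seminorm K j | K j. compact K \<and> K \<noteq> {}}"
  then obtain K j where K: "p = Cinf_seminorm K j" "K \<noteq> {}" by blast
  have "(SUP x\<in>K. 0::real) = 0" using K(2) by (rule cSUP_const)
  then show "p (\<lambda>x. 0) = 0"
    by (simp add: K(1) Cinf_seminorm_def nderiv_within_zero[OF closed_unbounded_interval_UNIV])
qed

lemma topspace_schwartz:
  assumes "closed_unbounded_interval I"
  shows "topspace (schwartz_topology I) = schwartz I"
  unfolding schwartz_topology_def
proof (rule topspace_seminorm_topology)
  fix p assume "p \<in> range (schwartz_seminorm I)"
  then obtain n where n: "p = schwartz_seminorm I n" by blast
  have "I \<noteq> {}" using assms by (auto simp: closed_unbounded_interval_def)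
  then have "schwartz_weight n I (\<lambda>x. 0) ` (I \<times> {0..n}) = {0}"
    using nderiv_within_zero[OF assms] by (force simp: schwartz_weight_def image_def)
  then show "p (\<lambda>x. 0) = 0" by (simp add: n schwartz_seminorm_def)
qed simp

end

(*
Let g = F o phi be a limit in S(R) of functions f o phi, with F smooth by the closed range in
C^infinity. The range of phi is a half-line, the part of it near infinity is already attained on I,
and only the decay of F there is in question. Since (f o phi)' = phi' (f' o phi), the closed range of
multiplication by phi' bounds f' o phi, and inductively all f^(j) o phi, by seminorms of f o phi.
These bounds are used only at points where phi' does not vanish; their images are dense in phi(I), so
nothing has to be known about the zeros of phi'. That multiplication by phi' is well defined forces
phi to grow at most polynomially on I, which turns decay in x into decay in y = phi(x).
*)
theory Submission
  imports Defs
begin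

section \<open>Iterated derivatives\<close>

text \<open>The obstacle is that multiplication by \<open>deriv \<phi>\<close> may have a kernel in
  S(I), so an open mapping argument controls \<open>v\<close> only modulo that kernel. At a point
  where \<open>deriv \<phi>\<close> is nonzero, however, every derivative of \<open>v\<close> is
  determined by the product, and the weighted evaluations at all such points are bounded on each
  single \<open>v\<close> because \<open>v\<close> is Schwartz. Uniform boundedness over S(I),
  equipped with the seminorms of the product in place of its own, makes the bounds uniform; the
  completeness this requires is what closedness of the range supplies. To iterate, a bound on the
  regular points must yield one on all of \<open>I\<close>: continuity carries it to the closure of
  the regular set, and elsewhere the product vanishes locally with all its derivatives. Off the
  range of \<phi> the function \<open>F\<close> is arbitrary, and a half-line range leaves room for
  a cutoff that changes \<open>F\<close> only there. That \<phi>(I) reaches the far end of the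
  half-line follows from properness of \<phi>, obtained by testing the symbol property on bump
  functions.\<close>

lemma at_within_unbounded_interval_neq_bot:
  assumes "closed_unbounded_interval I" "x \<in> I"
  shows "at x within I \<noteq> bot"
proof -
  have "connected I" "\<And>z. I \<noteq> {z}"
    using assms(1) by (auto simp: closed_unbounded_interval_def is_interval_connected)
  then show ?thesis
    using connected_imp_perfect[of I x] assms(2) by (simp add: trivial_limit_within)
qed

lemma closed_unbounded_interval_imp_convex:
  "closed_unbounded_interval I \<Longrightarrow> convex I"
  by (simp add: closed_unbounded_interval_def is_interval_convex)

lemma closed_unbounded_interval_nonempty:
  "closed_unbounded_interval I \<Longrightarrow> I \<noteq> {}"
  by (auto simp: closed_unbounded_interval_def)

text \<open>An explicit sequence of derivatives replaces \<open>vector_derivative\<close> in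
  calculations: smoothness is shown by exhibiting a sequence, and uniqueness then identifies it with
  \<open>nderiv_within\<close>.\<close>

definition has_derivs :: "real set \<Rightarrow> (real \<Rightarrow> real) \<Rightarrow> (nat \<Rightarrow> real \<Rightarrow> real) \<Rightarrow> bool" where
  "has_derivs I f D \<longleftrightarrow> (\<forall>x\<in>I. D 0 x = f x) \<and>
     (\<forall>n. \<forall>x\<in>I. (D n has_real_derivative D (Suc n) x) (at x within I))"

lemma has_derivsI:
  assumes "\<And>x. x \<in> I \<Longrightarrow> D 0 x = f x"
    and "\<And>n x. x \<in> I \<Longrightarrow> (D n has_real_derivative D (Suc n) x) (at x within I)"
  shows "has_derivs I f D"
  using assms by (simp add: has_derivs_def)

lemma has_derivs_0: "has_derivs I f D \<Longrightarrow> x \<in> I \<Longrightarrow> D 0 x = f x"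
  by (simp add: has_derivs_def)

lemma has_derivs_Suc:
  "has_derivs I f D \<Longrightarrow> x \<in> I \<Longrightarrow> (D n has_real_derivative D (Suc n) x) (at x within I)"
  by (simp add: has_derivs_def)

lemma nderiv_within_0 [simp]: "nderiv_within I 0 f = f"
  by (simp add: nderiv_within_def)

lemma nderiv_within_Suc:
  "nderiv_within I (Suc n) f x = vector_derivative (nderiv_within I n f) (at x within I)"
  by (simp add: nderiv_within_def)

lemma vector_derivative_within_eq:
  assumes "closed_unbounded_interval I" "x \<in> I" "(f has_real_derivative d) (at x within I)"
  shows "vector_derivative f (at x within I) = d"
  using vector_derivative_within[OF at_within_unbounded_interval_neq_bot] assms
  by (simp add: has_real_derivative_iff_has_vector_derivative)

text \<open>No point of \<open>I\<close> is isolated, so derivatives within \<open>I\<close> are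
  unique, also at an endpoint.\<close>

lemma nderiv_within_eq:
  assumes "closed_unbounded_interval I" "has_derivs I f D" "x \<in> I"
  shows "nderiv_within I n f x = D n x"
  using assms(3)
proof (induction n arbitrary: x)
  case 0
  then show ?case using assms(2) by (simp add: has_derivs_0)
next
  case (Suc n)
  have "(nderiv_within I n f has_real_derivative D (Suc n) x) (at x within I)"
    by (rule has_field_derivative_transform_within[OF has_derivs_Suc[OF assms(2) Suc.prems, of n] zero_less_one])
       (use Suc in auto)
  then show ?case
    using vector_derivative_within_eq[OF assms(1) Suc.prems] by (simp add: nderiv_within_Suc)
qed

lemma has_derivs_imp_smooth_on:
  assumes "closed_unbounded_interval I" "has_derivs I f D"
  shows "smooth_on I f"
  unfolding smooth_on_def
proof (intro allI)
  fix n
  have "(nderiv_within I n f has_real_derivative D (Suc n) x) (at x within I)" if "x \<in> I" for x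
    by (rule has_field_derivative_transform_within[OF has_derivs_Suc[OF assms(2) that, of n] zero_less_one])
       (use nderiv_within_eq[OF assms] that in auto)
  then show "nderiv_within I n f differentiable_on I"
    by (meson differentiable_on_def has_field_derivative_imp_has_derivative differentiable_def)
qed

lemma has_derivs_nderiv_within:
  assumes "smooth_on I f"
  shows "has_derivs I f (\<lambda>n. nderiv_within I n f)"
proof (rule has_derivsI)
  fix n x assume "x \<in> I"
  then have "nderiv_within I n f differentiable at x within I"
    using assms by (simp add: smooth_on_def differentiable_on_def)
  then show "(nderiv_within I n f has_real_derivative nderiv_within I (Suc n) f x) (at x within I)"
    by (simp add: nderiv_within_Suc has_real_derivative_iff_has_vector_derivative
        vector_derivative_works)
qed simp

lemma has_derivs_add:
  assumes "has_derivs I f D" "has_derivs I g E"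
  shows "has_derivs I (\<lambda>x. f x + g x) (\<lambda>n x. D n x + E n x)"
  using assms by (auto intro!: has_derivsI DERIV_add simp: has_derivs_def)

lemma has_derivs_cmult:
  assumes "has_derivs I f D"
  shows "has_derivs I (\<lambda>x. c * f x) (\<lambda>n x. c * D n x)"
  using assms by (auto intro!: has_derivsI DERIV_cmult simp: has_derivs_def)

lemma has_derivs_cong:
  assumes "has_derivs I f D" "\<And>x. x \<in> I \<Longrightarrow> f x = g x"
  shows "has_derivs I g D"
  using assms by (auto simp: has_derivs_def)

lemma has_derivs_subset:
  assumes "has_derivs I f D" "J \<subseteq> I"
  shows "has_derivs J f D"
  using assms unfolding has_derivs_def by (meson has_field_derivative_subset subsetD)

lemma has_derivs_affine:
  assumes "has_derivs UNIV f D"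
  shows "has_derivs UNIV (\<lambda>x. f (a * x + b)) (\<lambda>n x. a ^ n * D n (a * x + b))"
proof (rule has_derivsI)
  fix n x
  have "((\<lambda>x. D n (a * x + b)) has_real_derivative D (Suc n) (a * x + b) * a) (at x)"
    by (rule DERIV_chain2[where f="D n" and g="\<lambda>x. a * x + b"])
       (use assms has_derivs_Suc[of UNIV f D "a * x + b" n] in \<open>auto intro!: derivative_eq_intros\<close>)
  then show "((\<lambda>x. a ^ n * D n (a * x + b)) has_real_derivative a ^ Suc n * D (Suc n) (a * x + b)) (at x)"
    by (auto intro!: derivative_eq_intros)
qed (use assms in \<open>simp add: has_derivs_0\<close>)

text \<open>Shifting the sequences of derivatives avoids binomial coefficients in the iterated product
  rule.\<close>

fun prod_derivs :: "nat \<Rightarrow> (nat \<Rightarrow> real \<Rightarrow> real) \<Rightarrow> (nat \<Rightarrow> real \<Rightarrow> real) \<Rightarrow> real \<Rightarrow> real" where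
  "prod_derivs 0 D E x = D 0 x * E 0 x"
| "prod_derivs (Suc n) D E x =
     prod_derivs n (\<lambda>k. D (Suc k)) E x + prod_derivs n D (\<lambda>k. E (Suc k)) x"

lemma has_derivs_mult:
  assumes "has_derivs I f D" "has_derivs I g E"
  shows "has_derivs I (\<lambda>x. f x * g x) (\<lambda>n. prod_derivs n D E)"
proof (rule has_derivsI)
  fix n x assume x: "x \<in> I"
  have "(prod_derivs n D E has_real_derivative prod_derivs (Suc n) D E x) (at x within I)"
    if "\<And>n. (D n has_real_derivative D (Suc n) x) (at x within I)"
      and "\<And>n. (E n has_real_derivative E (Suc n) x) (at x within I)" for D E
    using that
  proof (induction n arbitrary: D E)
    case 0
    then show ?case
      using DERIV_mult[OF 0(1)[of 0] 0(2)[of 0]] by (simp add: fun_eq_iff mult.commute)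
  next
    case (Suc n)
    have "((\<lambda>x. prod_derivs n (\<lambda>k. D (Suc k)) E x + prod_derivs n D (\<lambda>k. E (Suc k)) x)
            has_real_derivative prod_derivs (Suc n) (\<lambda>k. D (Suc k)) E x
              + prod_derivs (Suc n) D (\<lambda>k. E (Suc k)) x) (at x within I)"
      by (intro DERIV_add Suc)
    then show ?case by (simp del: prod_derivs.simps add: prod_derivs.simps(2)[abs_def, of n] prod_derivs.simps(2)[of "Suc n"])
  qed
  then show "(prod_derivs n D E has_real_derivative prod_derivs (Suc n) D E x) (at x within I)"
    using assms x by (simp del: prod_derivs.simps add: has_derivs_def)
qed (use assms in \<open>simp add: has_derivs_0\<close>)

text \<open>The Leibniz rule solved for its top term: where \<open>D 0 x\<close> is nonzero,
  \<open>E n x\<close> can be recovered from the product and lower derivatives. The order of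
  quantifiers matters, since one \<open>c\<close> must serve all \<open>E\<close>.\<close>

lemma prod_derivs_leading_term:
  "\<exists>c. \<forall>E. prod_derivs n D E x = D 0 x * E n x + (\<Sum>i<n. c i * E i x)"
proof (induction n arbitrary: D)
  case (Suc n)
  obtain c where c: "\<And>E. prod_derivs n (\<lambda>k. D (Suc k)) E x = D 1 x * E n x + (\<Sum>i<n. c i * E i x)"
    using Suc.IH[of "\<lambda>k. D (Suc k)"] by auto
  obtain d where d: "\<And>E. prod_derivs n D E x = D 0 x * E n x + (\<Sum>i<n. d i * E i x)"
    using Suc.IH[of D] by auto
  \<comment> \<open>The first summand of the recursion contributes \<open>c\<close> and, as its
    leading term, \<open>D 1 x\<close> at index \<open>n\<close>; the second applies
    \<open>d\<close> to the shifted sequence, hence the index \<open>i - 1\<close>.\<close>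
  define e where "e = (\<lambda>i. (if i = n then D 1 x else c i) + (if i = 0 then 0 else d (i - 1)))"
  have "prod_derivs (Suc n) D E x = D 0 x * E (Suc n) x + (\<Sum>i<Suc n. e i * E i x)" for E
  proof -
    have "(\<Sum>i<Suc n. e i * E i x) = (\<Sum>i<Suc n. (if i = n then D 1 x else c i) * E i x)
        + (\<Sum>i<Suc n. (if i = 0 then 0 else d (i - 1)) * E i x)"
      by (simp only: e_def distrib_right sum.distrib)
    also have "(\<Sum>i<Suc n. (if i = n then D 1 x else c i) * E i x) = D 1 x * E n x + (\<Sum>i<n. c i * E i x)"
      by simp
    also have "(\<Sum>i<Suc n. (if i = 0 then 0 else d (i - 1)) * E i x) = (\<Sum>i<n. d i * E (Suc i) x)"
      by (simp only: sum.lessThan_Suc_shift) simp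
    finally show ?thesis by (simp add: c d)
  qed
  then show ?case by blast
qed auto

section \<open>Locality and restriction of derivatives\<close>

lemma nderiv_within_local:
  assumes I: "closed_unbounded_interval I"
    and f: "smooth_on I f" and g: "smooth_on I g"
    and U: "open U" "\<And>x. x \<in> U \<inter> I \<Longrightarrow> f x = g x"
    and x: "x \<in> U \<inter> I"
  shows "nderiv_within I n f x = nderiv_within I n g x"
  using x
proof (induction n arbitrary: x)
  case 0
  then show ?case using U by simp
next
  case (Suc n)
  obtain d where d: "d > 0" "ball x d \<subseteq> U"
    using U(1) Suc.prems open_contains_ball by blast
  have "(nderiv_within I n f has_real_derivative nderiv_within I (Suc n) f x) (at x within I)"
    using has_derivs_Suc[OF has_derivs_nderiv_within[OF f]] Suc.prems by blast
  then have "(nderiv_within I n g has_real_derivative nderiv_within I (Suc n) f x) (at x within I)"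
    by (rule has_field_derivative_transform_within[OF _ d(1)])
       (use Suc d in \<open>auto simp: dist_commute subset_iff\<close>)
  then have "nderiv_within I (Suc n) g x = nderiv_within I (Suc n) f x"
    using vector_derivative_within_eq[OF I] Suc.prems by (simp add: nderiv_within_Suc[of I n g])
  then show ?case by simp
qed

lemma continuous_on_nderiv_within:
  assumes "smooth_on I f"
  shows "continuous_on I (nderiv_within I n f)"
  using assms by (simp add: smooth_on_def differentiable_imp_continuous_on)

lemma nderiv_within_restriction:
  assumes "closed_unbounded_interval I" "smooth_on UNIV f" "x \<in> I"
  shows "nderiv_within I n f x = nderiv_within UNIV n f x"
  using nderiv_within_eq[OF assms(1) has_derivs_subset[OF has_derivs_nderiv_within[OF assms(2)]] assms(3)]
  by simp

lemma smooth_on_restriction: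
  assumes "closed_unbounded_interval I" "smooth_on UNIV f"
  shows "smooth_on I f"
  using has_derivs_imp_smooth_on[OF assms(1) has_derivs_subset[OF has_derivs_nderiv_within[OF assms(2)]]]
  by simp

lemma nderiv_within_1_eq_deriv: "nderiv_within UNIV 1 f = deriv f" if "smooth_on UNIV f"
proof
  fix x
  have "(f has_real_derivative nderiv_within UNIV 1 f x) (at x)"
    using has_derivs_Suc[OF has_derivs_nderiv_within[OF that], of x 0] by simp
  then show "nderiv_within UNIV 1 f x = deriv f x" by (simp add: DERIV_imp_deriv)
qed

section \<open>Schwartz functions on a closed unbounded interval\<close>

text \<open>Dropping \<open>extensional\<close> lets sums and products be formed pointwise without
  restricting them to \<open>I\<close> each time.\<close>

definition schwartz_on :: "real set \<Rightarrow> (real \<Rightarrow> real) \<Rightarrow> bool" where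
  "schwartz_on I f \<longleftrightarrow> smooth_on I f \<and>
     (\<forall>n. \<exists>B. \<forall>x\<in>I. \<forall>j\<le>n. (1 + x\<^sup>2) ^ n * \<bar>nderiv_within I j f x\<bar> \<le> B)"

lemma schwartz_onD:
  assumes "schwartz_on I f"
  shows "smooth_on I f"
    and "\<exists>B. \<forall>x\<in>I. \<forall>j\<le>n. (1 + x\<^sup>2) ^ n * \<bar>nderiv_within I j f x\<bar> \<le> B"
  using assms by (auto simp: schwartz_on_def)

lemma bdd_above_schwartz_weight_iff:
  "bdd_above (schwartz_weight n I f ` (I \<times> {0..n})) \<longleftrightarrow>
     (\<exists>B. \<forall>x\<in>I. \<forall>j\<le>n. (1 + x\<^sup>2) ^ n * \<bar>nderiv_within I j f x\<bar> \<le> B)"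
  by (force simp: bdd_above_def schwartz_weight_def)

lemma schwartz_iff: "f \<in> schwartz I \<longleftrightarrow> f \<in> extensional I \<and> schwartz_on I f"
  by (simp add: schwartz_def schwartz_on_def bdd_above_schwartz_weight_iff)

lemma schwartz_UNIV_iff: "f \<in> schwartz UNIV \<longleftrightarrow> schwartz_on UNIV f"
  by (simp add: schwartz_iff)

lemma schwartz_seminorm_le_iff:
  assumes "closed_unbounded_interval I" "schwartz_on I f"
  shows "schwartz_seminorm I n f \<le> B \<longleftrightarrow>
     (\<forall>x\<in>I. \<forall>j\<le>n. (1 + x\<^sup>2) ^ n * \<bar>nderiv_within I j f x\<bar> \<le> B)"
  unfolding schwartz_seminorm_def
  using closed_unbounded_interval_nonempty[OF assms(1)] schwartz_onD(2)[OF assms(2), of n]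
  by (subst cSup_le_iff) (auto simp: bdd_above_schwartz_weight_iff, auto simp: schwartz_weight_def)

lemma schwartz_seminorm_ge:
  assumes "closed_unbounded_interval I" "schwartz_on I f" "x \<in> I" "j \<le> n"
  shows "(1 + x\<^sup>2) ^ n * \<bar>nderiv_within I j f x\<bar> \<le> schwartz_seminorm I n f"
  using schwartz_seminorm_le_iff[OF assms(1,2), of n "schwartz_seminorm I n f"] assms(3,4) by simp

lemma nderiv_within_le_schwartz_seminorm:
  assumes "closed_unbounded_interval I" "schwartz_on I f" "x \<in> I" "j \<le> n"
  shows "\<bar>nderiv_within I j f x\<bar> \<le> schwartz_seminorm I n f"
proof -
  have "1 * \<bar>nderiv_within I j f x\<bar> \<le> (1 + x\<^sup>2) ^ n * \<bar>nderiv_within I j f x\<bar>"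
    by (intro mult_right_mono one_le_power) auto
  then show ?thesis using schwartz_seminorm_ge[OF assms] by simp
qed

lemma schwartz_seminorm_nonneg:
  assumes "closed_unbounded_interval I" "schwartz_on I f"
  shows "0 \<le> schwartz_seminorm I n f"
proof -
  obtain x where "x \<in> I" using closed_unbounded_interval_nonempty[OF assms(1)] by blast
  then show ?thesis
    using nderiv_within_le_schwartz_seminorm[OF assms, of x n n] by force
qed

lemma schwartz_seminorm_mono:
  assumes "closed_unbounded_interval I" "schwartz_on I f" "m \<le> n"
  shows "schwartz_seminorm I m f \<le> schwartz_seminorm I n f"
  unfolding schwartz_seminorm_le_iff[OF assms(1,2)]
proof (intro ballI allI impI)
  fix x j assume *: "x \<in> I" "j \<le> m"
  have "(1 + x\<^sup>2) ^ m * \<bar>nderiv_within I j f x\<bar> \<le> (1 + x\<^sup>2) ^ n * \<bar>nderiv_within I j f x\<bar>"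
    using assms(3) by (intro mult_right_mono power_increasing) auto
  then show "(1 + x\<^sup>2) ^ m * \<bar>nderiv_within I j f x\<bar> \<le> schwartz_seminorm I n f"
    using schwartz_seminorm_ge[OF assms(1,2), of x j n] * assms(3) by force
qed

section \<open>Algebraic operations on smooth and Schwartz functions\<close>

lemma nderiv_within_add:
  assumes "closed_unbounded_interval I" "smooth_on I f" "smooth_on I g" "x \<in> I"
  shows "nderiv_within I n (\<lambda>x. f x + g x) x = nderiv_within I n f x + nderiv_within I n g x"
  by (rule nderiv_within_eq[OF assms(1) has_derivs_add assms(4)])
     (use assms in \<open>auto intro: has_derivs_nderiv_within\<close>)

lemma nderiv_within_cmult:
  assumes "closed_unbounded_interval I" "smooth_on I f" "x \<in> I"
  shows "nderiv_within I n (\<lambda>x. c * f x) x = c * nderiv_within I n f x"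
  by (rule nderiv_within_eq[OF assms(1) has_derivs_cmult assms(3)])
     (use assms in \<open>auto intro: has_derivs_nderiv_within\<close>)

lemma nderiv_within_cong:
  assumes "closed_unbounded_interval I" "smooth_on I f" "\<And>x. x \<in> I \<Longrightarrow> f x = g x" "x \<in> I"
  shows "nderiv_within I n g x = nderiv_within I n f x"
  using nderiv_within_eq[OF assms(1) has_derivs_cong[OF has_derivs_nderiv_within[OF assms(2)] assms(3)] assms(4)] .

lemma smooth_on_cong:
  assumes "closed_unbounded_interval I" "smooth_on I f" "\<And>x. x \<in> I \<Longrightarrow> f x = g x"
  shows "smooth_on I g"
  using has_derivs_imp_smooth_on[OF assms(1) has_derivs_cong[OF has_derivs_nderiv_within[OF assms(2)] assms(3)]] .

lemma smooth_on_add: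
  assumes "closed_unbounded_interval I" "smooth_on I f" "smooth_on I g"
  shows "smooth_on I (\<lambda>x. f x + g x)"
  by (rule has_derivs_imp_smooth_on[OF assms(1) has_derivs_add])
     (use assms in \<open>auto intro: has_derivs_nderiv_within\<close>)

lemma smooth_on_cmult:
  assumes "closed_unbounded_interval I" "smooth_on I f"
  shows "smooth_on I (\<lambda>x. c * f x)"
  by (rule has_derivs_imp_smooth_on[OF assms(1) has_derivs_cmult])
     (use assms in \<open>auto intro: has_derivs_nderiv_within\<close>)

lemma smooth_on_mult:
  assumes "closed_unbounded_interval I" "smooth_on I f" "smooth_on I g"
  shows "smooth_on I (\<lambda>x. f x * g x)"
  by (rule has_derivs_imp_smooth_on[OF assms(1) has_derivs_mult])
     (use assms in \<open>auto intro: has_derivs_nderiv_within\<close>)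

lemma schwartz_on_cong:
  assumes "closed_unbounded_interval I" "schwartz_on I f" "\<And>x. x \<in> I \<Longrightarrow> f x = g x"
  shows "schwartz_on I g"
  using assms smooth_on_cong[OF assms(1) _ assms(3)] nderiv_within_cong[OF assms(1) _ assms(3)]
  by (simp add: schwartz_on_def)

lemma restrict_in_schwartz_iff:
  assumes "closed_unbounded_interval I"
  shows "restrict f I \<in> schwartz I \<longleftrightarrow> schwartz_on I f"
  using schwartz_on_cong[OF assms, of f "restrict f I"] schwartz_on_cong[OF assms, of "restrict f I" f]
  by (auto simp: schwartz_iff)

lemma schwartz_seminorm_cong:
  assumes "closed_unbounded_interval I" "schwartz_on I f" "\<And>x. x \<in> I \<Longrightarrow> f x = g x"
  shows "schwartz_seminorm I n g = schwartz_seminorm I n f"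
proof -
  have "schwartz_weight n I g ` (I \<times> {0..n}) = schwartz_weight n I f ` (I \<times> {0..n})"
    using nderiv_within_cong[OF assms(1) schwartz_onD(1)[OF assms(2)] assms(3)]
    by (intro image_cong) (auto simp: schwartz_weight_def)
  then show ?thesis by (simp add: schwartz_seminorm_def)
qed

lemma weighted_add_le:
  fixes w a b :: real
  assumes "w * \<bar>a\<bar> \<le> A" "w * \<bar>b\<bar> \<le> B" "0 \<le> w"
  shows "w * \<bar>a + b\<bar> \<le> A + B"
proof -
  have "w * \<bar>a + b\<bar> \<le> w * (\<bar>a\<bar> + \<bar>b\<bar>)" using assms(3) by (intro mult_left_mono) auto
  then show ?thesis using assms(1,2) by (simp add: distrib_left)
qed

lemma schwartz_on_add_aux:
  assumes I: "closed_unbounded_interval I" and f: "schwartz_on I f" and g: "schwartz_on I g"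
    and x: "x \<in> I" "j \<le> n"
  shows "(1 + x\<^sup>2) ^ n * \<bar>nderiv_within I j (\<lambda>x. f x + g x) x\<bar>
     \<le> schwartz_seminorm I n f + schwartz_seminorm I n g"
  using weighted_add_le[OF schwartz_seminorm_ge[OF I f x] schwartz_seminorm_ge[OF I g x]]
    nderiv_within_add[OF I schwartz_onD(1)[OF f] schwartz_onD(1)[OF g] x(1)] by simp

lemma schwartz_on_add:
  assumes "closed_unbounded_interval I" "schwartz_on I f" "schwartz_on I g"
  shows "schwartz_on I (\<lambda>x. f x + g x)"
  using schwartz_on_add_aux[OF assms] smooth_on_add[OF assms(1)] schwartz_onD(1) assms(2,3)
  unfolding schwartz_on_def by blast

lemma schwartz_seminorm_add:
  assumes "closed_unbounded_interval I" "schwartz_on I f" "schwartz_on I g"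
  shows "schwartz_seminorm I n (\<lambda>x. f x + g x) \<le> schwartz_seminorm I n f + schwartz_seminorm I n g"
  using schwartz_on_add_aux[OF assms] schwartz_seminorm_le_iff[OF assms(1) schwartz_on_add[OF assms]]
  by blast

lemma schwartz_on_cmult_aux:
  assumes I: "closed_unbounded_interval I" and f: "schwartz_on I f" and x: "x \<in> I" "j \<le> n"
  shows "(1 + x\<^sup>2) ^ n * \<bar>nderiv_within I j (\<lambda>x. c * f x) x\<bar> \<le> \<bar>c\<bar> * schwartz_seminorm I n f"
proof -
  have "(1 + x\<^sup>2) ^ n * \<bar>nderiv_within I j (\<lambda>x. c * f x) x\<bar>
      = \<bar>c\<bar> * ((1 + x\<^sup>2) ^ n * \<bar>nderiv_within I j f x\<bar>)"
    using nderiv_within_cmult[OF I schwartz_onD(1)[OF f] x(1)] by (simp add: abs_mult)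
  also have "\<dots> \<le> \<bar>c\<bar> * schwartz_seminorm I n f"
    by (intro mult_left_mono schwartz_seminorm_ge[OF I f x]) simp
  finally show ?thesis .
qed

lemma schwartz_on_cmult:
  assumes "closed_unbounded_interval I" "schwartz_on I f"
  shows "schwartz_on I (\<lambda>x. c * f x)"
  using schwartz_on_cmult_aux[OF assms] smooth_on_cmult[OF assms(1)] schwartz_onD(1) assms(2)
  unfolding schwartz_on_def by blast

lemma schwartz_seminorm_cmult:
  assumes "closed_unbounded_interval I" "schwartz_on I f"
  shows "schwartz_seminorm I n (\<lambda>x. c * f x) \<le> \<bar>c\<bar> * schwartz_seminorm I n f"
  using schwartz_on_cmult_aux[OF assms] schwartz_seminorm_le_iff[OF assms(1) schwartz_on_cmult[OF assms]]
  by blast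

lemma schwartz_on_diff:
  assumes "closed_unbounded_interval I" "schwartz_on I f" "schwartz_on I g"
  shows "schwartz_on I (\<lambda>x. f x - g x)"
  using schwartz_on_add[OF assms(1,2) schwartz_on_cmult[OF assms(1,3), of "-1"]] by simp

lemma schwartz_seminorm_minus_commute:
  assumes "closed_unbounded_interval I" "schwartz_on I f" "schwartz_on I g"
  shows "schwartz_seminorm I n (\<lambda>x. f x - g x) = schwartz_seminorm I n (\<lambda>x. g x - f x)"
proof -
  have "schwartz_seminorm I n (\<lambda>x. f x - g x) \<le> schwartz_seminorm I n (\<lambda>x. g x - f x)"
    if "schwartz_on I f" "schwartz_on I g" for f g
    using schwartz_seminorm_cmult[OF assms(1) schwartz_on_diff[OF assms(1) that(2,1)], of n "-1"] by simp
  then show ?thesis using assms by (simp add: antisym)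
qed

lemma schwartz_on_zero:
  assumes "closed_unbounded_interval I"
  shows "schwartz_on I (\<lambda>x. 0)"
proof -
  have "has_derivs I (\<lambda>x. 0) (\<lambda>n x. 0)" by (intro has_derivsI) auto
  then show ?thesis
    using has_derivs_imp_smooth_on[OF assms] nderiv_within_zero[OF assms]
    by (auto simp: schwartz_on_def)
qed

lemma schwartz_on_sum:
  assumes "closed_unbounded_interval I" "\<And>i. i \<in> A \<Longrightarrow> schwartz_on I (g i)"
  shows "schwartz_on I (\<lambda>x. \<Sum>i\<in>A. g i x)"
  using assms(2)
proof (induction A rule: infinite_finite_induct)
  case (insert i A)
  then show ?case using schwartz_on_add[OF assms(1), of "g i"] by simp
qed (use schwartz_on_zero[OF assms(1)] in auto)

lemma nderiv_within_sum:
  assumes "closed_unbounded_interval I" "\<And>i. i \<in> A \<Longrightarrow> schwartz_on I (g i)" "x \<in> I"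
  shows "nderiv_within I n (\<lambda>x. \<Sum>i\<in>A. g i x) x = (\<Sum>i\<in>A. nderiv_within I n (g i) x)"
  using assms(2)
proof (induction A rule: infinite_finite_induct)
  case (insert i A)
  then show ?case
    using nderiv_within_add[OF assms(1) schwartz_onD(1) schwartz_onD(1) assms(3), of "g i"]
      schwartz_on_sum[OF assms(1), of A g] by simp
qed (use nderiv_within_zero[OF assms(1,3)] in auto)

lemma nderiv_within_diff:
  assumes "closed_unbounded_interval I" "smooth_on I f" "smooth_on I g" "x \<in> I"
  shows "nderiv_within I n (\<lambda>x. f x - g x) x = nderiv_within I n f x - nderiv_within I n g x"
  using nderiv_within_add[OF assms(1,2) smooth_on_cmult[OF assms(1,3), of "-1"] assms(4)]
    nderiv_within_cmult[OF assms(1,3,4), of n "-1"] by simp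

text \<open>Completeness of S(I). Since seminorms increase with their index, the n-th term is at
  most \<open>(1/2) ^ n\<close> in every fixed seminorm from some index on; the series can therefore
  be differentiated term by term, and its tails are geometric.\<close>

lemma schwartz_on_series:
  assumes I: "closed_unbounded_interval I"
    and g: "\<And>n. schwartz_on I (g n)" "\<And>n. schwartz_seminorm I n (g n) \<le> (1/2) ^ n"
  shows "\<exists>h. schwartz_on I h \<and>
     (\<forall>k. (\<lambda>N. schwartz_seminorm I k (\<lambda>x. h x - (\<Sum>i<N. g i x))) \<longlonglongrightarrow> 0)"
proof -
  have bound: "(1 + x\<^sup>2) ^ k * \<bar>nderiv_within I j (g i) x\<bar> \<le> (1/2) ^ i"
    if "x \<in> I" "j \<le> k" "k \<le> i" for x j k i
    using schwartz_seminorm_ge[OF I g(1) that(1,2), of i] schwartz_seminorm_mono[OF I g(1) that(3), of i]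
      g(2)[of i] by linarith
  have bound0: "\<bar>nderiv_within I j (g i) x\<bar> \<le> (1/2) ^ i" if "x \<in> I" "j \<le> i" for x j i
    using nderiv_within_le_schwartz_seminorm[OF I g(1) that] g(2)[of i] by (rule order_trans)
  have summ: "summable (\<lambda>i. (1/2) ^ i :: real)" by simp
  define D where "D j x = (\<Sum>i. nderiv_within I j (g i) x)" for j x
  have unif: "uniform_limit I (\<lambda>n x. \<Sum>i<n. nderiv_within I j (g i) x) (D j) sequentially" for j
    unfolding D_def
    by (rule Weierstrass_m_test_ev[OF _ summ]) (use bound0 in \<open>auto simp: eventually_sequentially intro!: exI[of _ j]\<close>)
  have sm: "(\<lambda>i. nderiv_within I j (g i) x) sums D j x" if "x \<in> I" for j x
    using tendsto_uniform_limitI[OF unif that] by (simp add: sums_def)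
  have derivs: "has_derivs I (D 0) D"
  proof (rule has_derivsI)
    fix j x assume x: "x \<in> I"
    have "\<exists>G. \<forall>x\<in>I. (\<lambda>n. nderiv_within I j (g n) x) sums G x \<and>
         (G has_field_derivative D (Suc j) x) (at x within I)"
      by (rule has_field_derivative_series[OF closed_unbounded_interval_imp_convex[OF I] _ unif x])
         (use sm[OF x] has_derivs_Suc[OF has_derivs_nderiv_within[OF schwartz_onD(1)[OF g(1)]]] in
           \<open>auto simp: sums_iff\<close>)
    then obtain G where G: "\<And>x. x \<in> I \<Longrightarrow> (\<lambda>n. nderiv_within I j (g n) x) sums G x"
       "\<And>x. x \<in> I \<Longrightarrow> (G has_field_derivative D (Suc j) x) (at x within I)" by blast
    \<comment> \<open>Term-by-term differentiation produces some limit \<open>G\<close>; uniqueness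
      of sums identifies it with \<open>D j\<close> on \<open>I\<close>, which is all that a
      derivative within \<open>I\<close> sees.\<close>
    have "G y = D j y" if "y \<in> I" for y
      using G(1)[OF that] sm[OF that] by (rule sums_unique2)
    then show "(D j has_real_derivative D (Suc j) x) (at x within I)"
      using has_field_derivative_transform_within[OF G(2)[OF x] zero_less_one x] by blast
  qed simp
  define S where "S N x = (\<Sum>i<N. g i x)" for N x
  have S: "schwartz_on I (S N)" for N
    unfolding S_def by (intro schwartz_on_sum I g)
  have smD: "smooth_on I (D 0)" using has_derivs_imp_smooth_on[OF I derivs] .
  \<comment> \<open>The bound is the geometric series from index \<open>N\<close> on;
    \<open>k \<le> N\<close> puts every term of the tail in the range where its k-th seminorm is
    controlled.\<close>
  have tail: "(1 + x\<^sup>2) ^ k * \<bar>D j x - nderiv_within I j (S N) x\<bar> \<le> 2 * (1/2) ^ N"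
    if "x \<in> I" "j \<le> k" "k \<le> N" for x j k N
  proof -
    have "(\<lambda>i. nderiv_within I j (g (i + N)) x) sums (D j x - nderiv_within I j (S N) x)"
      using sums_split_initial_segment[OF sm[OF that(1), of j], of N] nderiv_within_sum[OF I _ that(1), where A="{..<N}" and n=j and g=g] g(1)
      by (simp add: S_def[abs_def] del: sum.lessThan_Suc)
    then have *: "(\<lambda>i. (1 + x\<^sup>2) ^ k * nderiv_within I j (g (i + N)) x) sums
        ((1 + x\<^sup>2) ^ k * (D j x - nderiv_within I j (S N) x))" by (rule sums_mult)
    have **: "norm ((1 + x\<^sup>2) ^ k * nderiv_within I j (g (i + N)) x) \<le> (1/2) ^ N * (1/2) ^ i" for i
      using bound[OF that(1,2), of "i + N"] that(3) by (simp add: abs_mult power_add mult.commute)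
    have ***: "(\<lambda>i. (1/2) ^ N * (1/2) ^ i) sums ((1/2) ^ N * 2 :: real)"
      using sums_mult[OF geometric_sums[of "1/2::real"], of "(1/2)^N"] by simp
    have "norm (\<Sum>i. (1 + x\<^sup>2) ^ k * nderiv_within I j (g (i + N)) x) \<le> (\<Sum>i. (1/2) ^ N * (1/2) ^ i)"
      by (rule norm_suminf_le[OF **]) (use *** in \<open>simp add: sums_iff\<close>)
    then show ?thesis using * *** by (simp add: sums_iff abs_mult mult.commute)
  qed
  have D: "schwartz_on I (D 0)"
    unfolding schwartz_on_def
  proof (intro conjI allI smD)
    fix n
    have "(1 + x\<^sup>2) ^ n * \<bar>nderiv_within I j (D 0) x\<bar> \<le> schwartz_seminorm I n (S n) + 2 * (1/2) ^ n"
      if "x \<in> I" "j \<le> n" for x j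
      using weighted_add_le[OF schwartz_seminorm_ge[OF I S[of n] that] tail[OF that order_refl]]
        nderiv_within_eq[OF I derivs that(1)] by simp
    then show "\<exists>B. \<forall>x\<in>I. \<forall>j\<le>n. (1 + x\<^sup>2) ^ n * \<bar>nderiv_within I j (D 0) x\<bar> \<le> B" by blast
  qed
  have "(\<lambda>N. schwartz_seminorm I k (\<lambda>x. D 0 x - S N x)) \<longlonglongrightarrow> 0" for k
  proof (rule tendsto_sandwich)
    show "\<forall>\<^sub>F N in sequentially. 0 \<le> schwartz_seminorm I k (\<lambda>x. D 0 x - S N x)"
      using schwartz_seminorm_nonneg[OF I schwartz_on_diff[OF I D S]] by simp
    have "schwartz_seminorm I k (\<lambda>x. D 0 x - S N x) \<le> 2 * (1/2) ^ N" if "k \<le> N" for N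
      unfolding schwartz_seminorm_le_iff[OF I schwartz_on_diff[OF I D S]]
      using tail that nderiv_within_diff[OF I smD schwartz_onD(1)[OF S]] nderiv_within_eq[OF I derivs]
      by simp
    then show "\<forall>\<^sub>F N in sequentially. schwartz_seminorm I k (\<lambda>x. D 0 x - S N x) \<le> 2 * (1/2) ^ N"
      by (auto simp: eventually_sequentially)
    show "(\<lambda>N. 2 * (1/2) ^ N :: real) \<longlonglongrightarrow> 0"
      by (intro tendsto_mult_right_zero LIMSEQ_power_zero) simp
  qed simp
  with D show ?thesis by (auto simp: S_def)
qed

section \<open>Uniform boundedness\<close>

text \<open>The uniform boundedness principle, by the gliding hump argument: only completeness of \<open>V\<close>
  for absolutely convergent series is needed, not Baire's theorem, and \<open>p\<close> need not separate
  points.\<close>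

lemma uniform_boundedness_seminorms:
  fixes V :: "(real \<Rightarrow> real) set" and p :: "nat \<Rightarrow> (real \<Rightarrow> real) \<Rightarrow> real"
    and q :: "'a \<Rightarrow> (real \<Rightarrow> real) \<Rightarrow> real"
  assumes V_zero: "(\<lambda>x. 0) \<in> V"
    and V_add: "\<And>f g. f \<in> V \<Longrightarrow> g \<in> V \<Longrightarrow> (\<lambda>x. f x + g x) \<in> V"
    and V_cmult: "\<And>c f. f \<in> V \<Longrightarrow> (\<lambda>x. c * f x) \<in> V"
    and p_nonneg: "\<And>k f. f \<in> V \<Longrightarrow> 0 \<le> p k f"
    and p_mono: "\<And>k l f. f \<in> V \<Longrightarrow> k \<le> l \<Longrightarrow> p k f \<le> p l f"
    and p_cmult: "\<And>k c f. f \<in> V \<Longrightarrow> p k (\<lambda>x. c * f x) \<le> \<bar>c\<bar> * p k f"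
    and complete: "\<And>g. (\<And>n. g n \<in> V) \<Longrightarrow> (\<And>n. p n (g n) \<le> (1/2) ^ n) \<Longrightarrow>
        \<exists>h\<in>V. \<forall>k. (\<lambda>N. p k (\<lambda>x. h x - (\<Sum>i<N. g i x))) \<longlonglongrightarrow> 0"
    and q_add: "\<And>a f g. a \<in> J \<Longrightarrow> f \<in> V \<Longrightarrow> g \<in> V \<Longrightarrow> q a (\<lambda>x. f x + g x) \<le> q a f + q a g"
    and q_cmult: "\<And>a c f. a \<in> J \<Longrightarrow> f \<in> V \<Longrightarrow> q a (\<lambda>x. c * f x) = \<bar>c\<bar> * q a f"
    and q_cont: "\<And>a. a \<in> J \<Longrightarrow> \<exists>C k. \<forall>f\<in>V. q a f \<le> C * p k f"
    and q_bdd: "\<And>f. f \<in> V \<Longrightarrow> \<exists>B. \<forall>a\<in>J. q a f \<le> B"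
  shows "\<exists>C\<ge>0. \<exists>k. \<forall>a\<in>J. \<forall>f\<in>V. q a f \<le> C * p k f"
proof (rule ccontr)
  assume neg: "\<not> ?thesis"
  \<comment> \<open>Failure of the estimate with constant \<open>L / d\<close> gives a pair that is
    rescaled to make \<open>q\<close> exactly \<open>L\<close>; the same scaling brings
    \<open>p k\<close> below \<open>d\<close>.\<close>
  have big: "\<exists>a\<in>J. \<exists>f\<in>V. q a f = L \<and> p k f < d" if "L > 0" "d > 0" for L d k
  proof -
    have "L / d \<ge> 0" using that by simp
    then obtain a f where af: "a \<in> J" "f \<in> V" "q a f > L / d * p k f"
      using neg by (meson not_le)
    have "L / d * p k f \<ge> 0" using that p_nonneg[OF af(2)] by simp
    then have pos: "q a f > 0" using af(3) by linarith
    have "q a (\<lambda>x. L / q a f * f x) = L"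
      using q_cmult[OF af(1,2), of "L / q a f"] pos that(1) by simp
    moreover have "p k (\<lambda>x. L / q a f * f x) < d"
    proof -
      have "p k (\<lambda>x. L / q a f * f x) \<le> L / q a f * p k f"
        using p_cmult[OF af(2), of k "L / q a f"] pos that(1) by simp
      also have "\<dots> < d" using af(3) pos that by (simp add: field_simps)
      finally show ?thesis .
    qed
    ultimately show ?thesis using V_cmult[OF af(2)] af(1) by blast
  qed
  obtain C0 K where C0: "\<And>a f. a \<in> J \<Longrightarrow> f \<in> V \<Longrightarrow> q a f \<le> C0 a * p (K a) f"
    using q_cont by metis
  obtain B where B: "\<And>a f. a \<in> J \<Longrightarrow> f \<in> V \<Longrightarrow> q a f \<le> B f"
    using q_bdd by metis
  \<comment> \<open>The constants of \<open>q_cont\<close> may be negative; absolute values make the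
    later monotonicity arguments valid.\<close>
  define C where "C a = \<bar>C0 a\<bar>" for a
  have C: "q a f \<le> C a * p (K a) f" if "a \<in> J" "f \<in> V" for a f
  proof -
    have "C0 a * p (K a) f \<le> C a * p (K a) f"
      unfolding C_def by (intro mult_right_mono p_nonneg that) simp
    then show ?thesis using C0[OF that] by linarith
  qed
  \<comment> \<open>A state holds a functional \<open>a\<close>, its hump \<open>f\<close>, the
    index \<open>k\<close> and factor \<open>M\<close> that measure how small the hump is, and the
    sum \<open>S\<close> of the bounds \<open>B\<close> over earlier humps. In
    \<open>real n + 3 + S\<close>, the part \<open>S\<close> pays for earlier humps, 2 for later
    ones, 1 for the remainder of the series, and \<open>n\<close> is left over.\<close>
  define P where "P n s \<longleftrightarrow> (case s of (a, f, k, M, S) \<Rightarrow>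
      a \<in> J \<and> f \<in> V \<and> n \<le> k \<and> 0 \<le> M \<and> 0 \<le> S \<and> q a f = real n + 3 + S \<and>
      p k f < (1/2) ^ n / (1 + M))" for n and s :: "'a \<times> (real \<Rightarrow> real) \<times> nat \<times> real \<times> real"
  \<comment> \<open>The next hump is measured with an index and a factor dominating those of all
    functionals already chosen, so every earlier functional is small on it.\<close>
  define Q where "Q s t \<longleftrightarrow> (case s of (a, f, k, M, S) \<Rightarrow> case t of (a', f', k', M', S') \<Rightarrow>
      k \<le> k' \<and> K a \<le> k' \<and> M \<le> M' \<and> C a \<le> M' \<and> S' = S + \<bar>B f\<bar>)"
    for s t :: "'a \<times> (real \<Rightarrow> real) \<times> nat \<times> real \<times> real"
  have "\<exists>s. \<forall>n. P n (s n) \<and> Q (s n) (s (Suc n))"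
  proof (rule dependent_nat_choice)
    obtain a f where "a \<in> J" "f \<in> V" "q a f = 3" "p 0 f < 1"
      using big[of 3 1 0] by auto
    then have "P 0 (a, f, 0, 0, 0)" by (simp add: P_def)
    then show "\<exists>s. P 0 s" by blast
  next
    fix s n assume s: "P n s"
    obtain a f k M S where s_eq: "s = (a, f, k, M, S)" by (cases s) auto
    define k' M' S' where "k' = max (Suc n) (max k (K a))" and "M' = max M (C a)" and "S' = S + \<bar>B f\<bar>"
    have pos: "M' \<ge> 0" "S' \<ge> 0" using s by (auto simp: P_def s_eq M'_def S'_def)
    obtain a' f' where "a' \<in> J" "f' \<in> V" "q a' f' = real (Suc n) + 3 + S'"
        "p k' f' < (1/2) ^ Suc n / (1 + M')"
      using big[of "real (Suc n) + 3 + S'" "(1/2) ^ Suc n / (1 + M')" k'] pos by auto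
    then have "P (Suc n) (a', f', k', M', S') \<and> Q s (a', f', k', M', S')"
      using pos by (simp add: P_def Q_def s_eq k'_def M'_def S'_def le_max_iff_disj)
    then show "\<exists>t. P (Suc n) t \<and> Q s t" by blast
  qed
  then obtain s where s: "\<And>n. P n (s n)" "\<And>n. Q (s n) (s (Suc n))" by blast
  define a where "a n = fst (s n)" for n
  define f where "f n = fst (snd (s n))" for n
  define k where "k n = fst (snd (snd (s n)))" for n
  define M where "M n = fst (snd (snd (snd (s n))))" for n
  define S where "S n = snd (snd (snd (snd (s n))))" for n
  have s_eq: "s n = (a n, f n, k n, M n, S n)" for n
    by (simp add: a_def f_def k_def M_def S_def)
  have props: "a n \<in> J" "f n \<in> V" "n \<le> k n" "0 \<le> M n" "0 \<le> S n" "q (a n) (f n) = real n + 3 + S n"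
      "p (k n) (f n) < (1/2) ^ n / (1 + M n)" for n
    using s(1)[of n] unfolding s_eq P_def by auto
  have step: "k n \<le> k (Suc n)" "K (a n) \<le> k (Suc n)" "M n \<le> M (Suc n)" "C (a n) \<le> M (Suc n)"
      "S (Suc n) = S n + \<bar>B (f n)\<bar>" for n
    using s(2)[of n] unfolding s_eq Q_def by auto
  have mono: "k i \<le> k n" "M i \<le> M n" if "i \<le> n" for i n
    using that step by (auto intro: lift_Suc_mono_le)
  have later: "K (a i) \<le> k n" "C (a i) \<le> M n" if "i < n" for i n
    using step(2,4)[of i] mono[of "Suc i" n] that by auto
  have S: "(\<Sum>i<n. \<bar>B (f i)\<bar>) \<le> S n" for n
    using props(5) by (induction n) (auto simp: step(5))
  have p_small: "p (k n) (f n) \<le> (1/2) ^ n" and Mp_small: "M n * p (k n) (f n) \<le> (1/2) ^ n" for n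
  proof -
    have "(1 + M n) * p (k n) (f n) < (1/2) ^ n"
      using props(7)[of n] pos_less_divide_eq[of "1 + M n"] props(4)[of n] by (simp add: mult.commute)
    moreover have "0 \<le> M n * p (k n) (f n)" "0 \<le> p (k n) (f n)"
      using props(4) p_nonneg[OF props(2)] by auto
    ultimately show "p (k n) (f n) \<le> (1/2) ^ n" "M n * p (k n) (f n) \<le> (1/2) ^ n"
      by (simp_all add: distrib_right)
  qed
  have q_small: "q (a i) (f n) \<le> (1/2) ^ n" if "i < n" for i n
  proof -
    have "q (a i) (f n) \<le> C (a i) * p (K (a i)) (f n)" using C props by blast
    also have "\<dots> \<le> M n * p (k n) (f n)"
      using later[OF that] props p_mono[OF props(2)] p_nonneg[OF props(2)]
      by (intro mult_mono) auto
    also have "\<dots> \<le> (1/2) ^ n" by (rule Mp_small)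
    finally show ?thesis .
  qed
  have "p n (f n) \<le> (1/2) ^ n" for n
    using p_mono[OF props(2) props(3)] p_small order_trans by blast
  then obtain h where h: "h \<in> V" "\<And>k. (\<lambda>N. p k (\<lambda>x. h x - (\<Sum>i<N. f i x))) \<longlonglongrightarrow> 0"
    using complete[of f] props(2) by blast
  have V_sum: "(\<lambda>x. \<Sum>i\<in>A. f i x) \<in> V" if "finite A" for A
    using that by (induction A) (auto intro: V_zero V_add props)
  have q_sum: "q b (\<lambda>x. \<Sum>i\<in>A. f i x) \<le> (\<Sum>i\<in>A. q b (f i))" if "b \<in> J" "finite A" for A b
    using that(2)
  proof (induction A)
    case empty
    show ?case using q_cmult[OF that(1) V_zero, of 0] by simp
  next
    case (insert i A)
    then show ?case using q_add[OF that(1) props(2) V_sum[OF insert(1)], of i] by simp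
  qed
  have V_diff: "(\<lambda>x. u x - v x) \<in> V" if "u \<in> V" "v \<in> V" for u v
    using V_add[OF that(1) V_cmult[OF that(2), of "-1"]] by simp
  have q_diff: "q b (\<lambda>x. u x - v x) \<le> q b u + q b v" if "b \<in> J" "u \<in> V" "v \<in> V" for u v b
    using q_add[OF that(1,2) V_cmult[OF that(3), of "-1"]] q_cmult[OF that(1,3), of "-1"] by simp
  have "real n \<le> B h" for n
  proof -
    have "(\<lambda>N. C (a n) * p (K (a n)) (\<lambda>x. h x - (\<Sum>i<N. f i x))) \<longlonglongrightarrow> 0"
      by (intro tendsto_mult_right_zero h)
    then have "\<forall>\<^sub>F N in sequentially. C (a n) * p (K (a n)) (\<lambda>x. h x - (\<Sum>i<N. f i x)) < 1"
      by (rule order_tendstoD) simp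
    then obtain N where N: "N > n" "C (a n) * p (K (a n)) (\<lambda>x. h x - (\<Sum>i<N. f i x)) < 1"
      using eventually_happens'[OF _ eventually_conj[OF eventually_gt_at_top[of n]]] by auto
    define A where "A = {..<N} - {n}"
    have sum_eq: "(\<Sum>i<N. g i) = g n + (\<Sum>i\<in>A. g i)" for g :: "nat \<Rightarrow> real"
      unfolding A_def using N(1) by (simp add: sum.remove)
    \<comment> \<open>Hump \<open>n\<close> is isolated as \<open>h\<close> minus the remainder of
      the series and the other humps, so that subadditivity bounds \<open>q (a n) h\<close> from
      below.\<close>
    have "f n = (\<lambda>x. h x - ((h x - (\<Sum>i<N. f i x)) + (\<Sum>i\<in>A. f i x)))"
      by (simp add: sum_eq fun_eq_iff)
    then have "q (a n) (f n) \<le> q (a n) h + q (a n) (\<lambda>x. (h x - (\<Sum>i<N. f i x)) + (\<Sum>i\<in>A. f i x))"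
      using q_diff[OF props(1)[of n] h(1) V_add[OF V_diff[OF h(1) V_sum[of "{..<N}"]] V_sum[of A]]]
      by (simp add: A_def)
    also have "q (a n) (\<lambda>x. (h x - (\<Sum>i<N. f i x)) + (\<Sum>i\<in>A. f i x))
        \<le> q (a n) (\<lambda>x. h x - (\<Sum>i<N. f i x)) + q (a n) (\<lambda>x. \<Sum>i\<in>A. f i x)"
      by (intro q_add V_diff V_sum h props) (auto simp: A_def)
    also have "q (a n) (\<lambda>x. h x - (\<Sum>i<N. f i x)) \<le> 1"
      using C[OF props(1)[of n] V_diff[OF h(1) V_sum[of "{..<N}"]]] N(2) by simp
    also have "q (a n) (\<lambda>x. \<Sum>i\<in>A. f i x) \<le> S n + 2"
    proof -
      have "q (a n) (\<lambda>x. \<Sum>i\<in>A. f i x) \<le> (\<Sum>i\<in>A. q (a n) (f i))"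
        by (rule q_sum[OF props(1)]) (simp add: A_def)
      \<comment> \<open>Earlier humps are controlled by pointwise boundedness of the family, later
        ones by their construction.\<close>
      also have "\<dots> \<le> (\<Sum>i\<in>A. (if i < n then \<bar>B (f i)\<bar> else 0) + (1/2) ^ i)"
      proof (rule sum_mono)
        fix i assume "i \<in> A"
        then have "i \<noteq> n" by (simp add: A_def)
        then consider "i < n" | "n < i" by linarith
        then show "q (a n) (f i) \<le> (if i < n then \<bar>B (f i)\<bar> else 0) + (1/2) ^ i"
        proof cases
          case 1
          have "q (a n) (f i) \<le> \<bar>B (f i)\<bar>" using B[OF props(1,2), of n i] by linarith
          then show ?thesis using 1 by (simp add: add_increasing2)
        qed (use q_small in auto)
      qed
      also have "\<dots> \<le> (\<Sum>i<N. (if i < n then \<bar>B (f i)\<bar> else 0) + (1/2) ^ i)"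
        by (rule sum_mono2) (auto simp: A_def)
      also have "\<dots> = (\<Sum>i<n. \<bar>B (f i)\<bar>) + (\<Sum>i<N. (1/2) ^ i)"
        using N(1) by (simp add: sum.distrib sum.If_cases Int_absorb1 subset_eq flip: lessThan_def)
      also have "(\<Sum>i<N. (1/2) ^ i) \<le> (2::real)"
        using sum_le_suminf[of "\<lambda>i. (1/2) ^ i :: real" "{..<N}"] suminf_geometric[of "1/2::real"] by simp
      finally show ?thesis using S[of n] by simp
    qed
    finally show ?thesis using B[OF props(1) h(1), of n] props(6)[of n] by linarith
  qed
  then show False using reals_Archimedean2[of "B h"] by (meson not_le)
qed

section \<open>Closed sets in seminorm topologies\<close>

text \<open>The generating balls have arbitrary centres, so induction over the generated topology is
  used to find, inside each open set around \<open>v\<close>, a ball centred at \<open>v\<close> for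
  finitely many seminorms.\<close>

lemma closedin_seminorm_topologyD:
  assumes top: "topspace (seminorm_topology X P) = X"
    and tri: "\<And>p f g h. p \<in> P \<Longrightarrow> f \<in> X \<Longrightarrow> g \<in> X \<Longrightarrow> h \<in> X \<Longrightarrow>
        p (\<lambda>x. f x - h x) \<le> p (\<lambda>x. f x - g x) + p (\<lambda>x. g x - h x)"
    and closed: "closedin (seminorm_topology X P) A"
    and v: "v \<in> X"
    and approx: "\<And>Q e. finite Q \<Longrightarrow> Q \<subseteq> P \<Longrightarrow> e > 0 \<Longrightarrow> \<exists>a\<in>A. \<forall>p\<in>Q. p (\<lambda>x. a x - v x) < e"
  shows "v \<in> A"
proof (rule ccontr)
  assume "v \<notin> A"
  let ?S = "{{g \<in> X. p (\<lambda>x. g x - f x) < e} | f p e. f \<in> X \<and> p \<in> P \<and> e > 0}"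
  have "openin (seminorm_topology X P) (X - A)"
    using closed top by (simp add: closedin_def)
  then have gen: "generate_topology_on ?S (X - A)"
    unfolding seminorm_topology_def by (rule openin_topology_generated_by)
  have nbhd: "\<exists>Q e. finite Q \<and> Q \<subseteq> P \<and> e > 0 \<and> {g \<in> X. \<forall>p\<in>Q. p (\<lambda>x. g x - v x) < e} \<subseteq> U"
    if "generate_topology_on ?S U" "v \<in> U" for U
    using that
  proof (induction rule: generate_topology_on.induct)
    case (Int U1 U2)
    then obtain Q1 e1 Q2 e2 where *: "finite Q1" "Q1 \<subseteq> P" "e1 > (0::real)"
        "{g \<in> X. \<forall>p\<in>Q1. p (\<lambda>x. g x - v x) < e1} \<subseteq> U1" "finite Q2" "Q2 \<subseteq> P" "e2 > (0::real)"
        "{g \<in> X. \<forall>p\<in>Q2. p (\<lambda>x. g x - v x) < e2} \<subseteq> U2" by auto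
    show ?case
      by (rule exI[of _ "Q1 \<union> Q2"], rule exI[of _ "min e1 e2"]) (use * in \<open>auto; blast\<close>)
  next
    case (UN K)
    then obtain U where U: "U \<in> K" "v \<in> U" by blast
    show ?case using UN.IH[OF U] Union_upper[OF U(1)] by (meson subset_trans)
  next
    \<comment> \<open>By the triangle inequality the ball around \<open>f\<close> contains one
      around \<open>v\<close>, with the radius reduced by the distance from \<open>v\<close> to
      \<open>f\<close>.\<close>
    case (Basis U)
    then obtain f p e where U: "U = {g \<in> X. p (\<lambda>x. g x - f x) < e}" "f \<in> X" "p \<in> P" by blast
    have "{g \<in> X. p (\<lambda>x. g x - v x) < e - p (\<lambda>x. v x - f x)} \<subseteq> U"
      using tri[OF U(3) _ v U(2)] by (force simp: U(1))
    then show ?case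
      using U Basis(2) by (intro exI[of _ "{p}"] exI[of _ "e - p (\<lambda>x. v x - f x)"]) auto
  qed simp
  obtain Q e where "finite Q" "Q \<subseteq> P" "e > 0"
      "{g \<in> X. \<forall>p\<in>Q. p (\<lambda>x. g x - v x) < e} \<subseteq> X - A"
    using nbhd[OF gen] v \<open>v \<notin> A\<close> by auto
  moreover have "A \<subseteq> X" using closedin_subset[OF closed] top by simp
  ultimately show False using approx[of Q e] by blast
qed

text \<open>If some seminorm keeps \<open>v\<close> at a positive distance from \<open>A\<close>,
  its ball around \<open>v\<close> is a generating open set that misses \<open>A\<close>;
  \<open>zero\<close> puts \<open>v\<close> into that ball.\<close>

lemma closedin_seminorm_topologyI:
  assumes top: "topspace (seminorm_topology X P) = X"
    and zero: "\<And>p. p \<in> P \<Longrightarrow> p (\<lambda>x. 0) = 0"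
    and A: "A \<subseteq> X"
    and v: "\<And>v. v \<in> X \<Longrightarrow> (\<And>p e. p \<in> P \<Longrightarrow> e > 0 \<Longrightarrow> \<exists>a\<in>A. p (\<lambda>x. a x - v x) < e) \<Longrightarrow> v \<in> A"
  shows "closedin (seminorm_topology X P) A"
proof -
  have "\<exists>T. openin (seminorm_topology X P) T \<and> v \<in> T \<and> T \<subseteq> X - A" if vA: "v \<in> X - A" for v
  proof -
    have "\<not> (\<forall>p e. p \<in> P \<longrightarrow> e > 0 \<longrightarrow> (\<exists>a\<in>A. p (\<lambda>x. a x - v x) < e))"
      using v[of v] vA by auto
    then
    obtain p e where pe: "p \<in> P" "e > 0" "\<And>a. a \<in> A \<Longrightarrow> \<not> p (\<lambda>x. a x - v x) < e"
      by blast
    have "openin (seminorm_topology X P) {g \<in> X. p (\<lambda>x. g x - v x) < e}"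
      unfolding seminorm_topology_def
      by (rule topology_generated_by_Basis) (use vA pe in blast)
    moreover have "v \<in> {g \<in> X. p (\<lambda>x. g x - v x) < e}"
      using vA pe(2) zero[OF pe(1)] by simp
    ultimately show ?thesis using pe(3) by blast
  qed
  then have "openin (seminorm_topology X P) (X - A)"
    by (subst openin_subopen) blast
  then show ?thesis using A top by (simp add: closedin_def)
qed

section \<open>Closedness in the Schwartz and smooth function topologies\<close>

lemma schwartz_seminorm_triangle:
  assumes "closed_unbounded_interval I" "schwartz_on I f" "schwartz_on I g" "schwartz_on I h"
  shows "schwartz_seminorm I n (\<lambda>x. f x - h x)
     \<le> schwartz_seminorm I n (\<lambda>x. f x - g x) + schwartz_seminorm I n (\<lambda>x. g x - h x)"
  using schwartz_seminorm_add[OF assms(1) schwartz_on_diff[OF assms(1,2,3)] schwartz_on_diff[OF assms(1,3,4)]]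
  by simp

lemma schwartz_seminorm_zero:
  assumes "closed_unbounded_interval I"
  shows "schwartz_seminorm I n (\<lambda>x. 0) = 0"
  using schwartz_seminorm_cmult[OF assms schwartz_on_zero[OF assms], of n 0]
    schwartz_seminorm_nonneg[OF assms schwartz_on_zero[OF assms], of n] by simp

text \<open>The seminorms increase with their index, so finitely many of them are dominated by a
  single one.\<close>

lemma closedin_schwartz_topologyD:
  assumes I: "closed_unbounded_interval I" and closed: "closedin (schwartz_topology I) A"
    and v: "v \<in> schwartz I"
    and approx: "\<And>k e. e > 0 \<Longrightarrow> \<exists>a\<in>A. schwartz_seminorm I k (\<lambda>x. a x - v x) < e"
  shows "v \<in> A"
proof (rule closedin_seminorm_topologyD[OF topspace_schwartz[OF I, unfolded schwartz_topology_def]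
      _ closed[unfolded schwartz_topology_def] v])
  fix Q and e :: real assume Q: "finite Q" "Q \<subseteq> range (schwartz_seminorm I)" "e > 0"
  then obtain N where N: "finite N" "Q = schwartz_seminorm I ` N"
    using finite_subset_image by metis
  \<comment> \<open>\<open>insert 0\<close> covers an empty set of seminorms, for which
    \<open>Max N\<close> has no meaning.\<close>
  obtain a where a: "a \<in> A" "schwartz_seminorm I (Max (insert 0 N)) (\<lambda>x. a x - v x) < e"
    using approx[OF Q(3)] by blast
  have "a \<in> schwartz I" using closedin_subset[OF closed] topspace_schwartz[OF I] a(1) by auto
  then have "schwartz_on I (\<lambda>x. a x - v x)"
    using v schwartz_on_diff[OF I] by (simp add: schwartz_iff)
  then have "schwartz_seminorm I n (\<lambda>x. a x - v x) < e" if "n \<in> N" for n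
    using schwartz_seminorm_mono[OF I, of _ n "Max (insert 0 N)"] a(2) that N(1) by (force simp: Max_ge)
  then show "\<exists>a\<in>A. \<forall>p\<in>Q. p (\<lambda>x. a x - v x) < e" using a(1) N(2) by blast
qed (use schwartz_seminorm_triangle[OF I] in \<open>auto simp: schwartz_iff\<close>)

lemma closedin_schwartz_topologyI:
  assumes I: "closed_unbounded_interval I" and "A \<subseteq> schwartz I"
    and "\<And>v. v \<in> schwartz I \<Longrightarrow>
      (\<And>k e. e > 0 \<Longrightarrow> \<exists>a\<in>A. schwartz_seminorm I k (\<lambda>x. a x - v x) < e) \<Longrightarrow> v \<in> A"
  shows "closedin (schwartz_topology I) A"
  unfolding schwartz_topology_def
  by (rule closedin_seminorm_topologyI[OF topspace_schwartz[OF I, unfolded schwartz_topology_def]])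
     (use assms schwartz_seminorm_zero[OF I] in auto)

lemma Cinf_seminorm_le:
  assumes "compact K" "K \<noteq> {}" "smooth_on UNIV f" "x \<in> K"
  shows "\<bar>nderiv_within UNIV j f x\<bar> \<le> Cinf_seminorm K j f"
proof -
  have "continuous_on K (\<lambda>x. \<bar>nderiv_within UNIV j f x\<bar>)"
    using continuous_on_nderiv_within[OF assms(3)] by (intro continuous_intros) (auto intro: continuous_on_subset)
  then have "bdd_above ((\<lambda>x. \<bar>nderiv_within UNIV j f x\<bar>) ` K)"
    using assms(1) by (intro bounded_imp_bdd_above compact_imp_bounded compact_continuous_image)
  then show ?thesis unfolding Cinf_seminorm_def using assms(4) by (rule cSUP_upper2[OF _ _ order_refl])
qed

text \<open>Continuity of the inclusion of S(R) into the smooth functions, by which a limit in S(R)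
  is also a limit there.\<close>

lemma Cinf_seminorm_le_schwartz_seminorm:
  assumes "K \<noteq> {}" "schwartz_on UNIV f" "j \<le> n"
  shows "Cinf_seminorm K j f \<le> schwartz_seminorm UNIV n f"
  unfolding Cinf_seminorm_def
  by (rule cSUP_least[OF assms(1)])
     (use nderiv_within_le_schwartz_seminorm[OF closed_unbounded_interval_UNIV assms(2) _ assms(3)] in auto)

lemma Cinf_seminorm_triangle:
  assumes K: "compact K" "K \<noteq> {}" and f: "smooth_on UNIV f" and g: "smooth_on UNIV g"
    and h: "smooth_on UNIV h"
  shows "Cinf_seminorm K j (\<lambda>x. f x - h x)
     \<le> Cinf_seminorm K j (\<lambda>x. f x - g x) + Cinf_seminorm K j (\<lambda>x. g x - h x)"
proof -
  note U = closed_unbounded_interval_UNIV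
  have diff: "smooth_on UNIV (\<lambda>x. u x - v x)" if "smooth_on UNIV u" "smooth_on UNIV v" for u v
    using smooth_on_add[OF U that(1) smooth_on_cmult[OF U that(2), of "-1"]] by simp
  have "\<bar>nderiv_within UNIV j (\<lambda>x. f x - h x) x\<bar>
      \<le> Cinf_seminorm K j (\<lambda>x. f x - g x) + Cinf_seminorm K j (\<lambda>x. g x - h x)" if "x \<in> K" for x
    using nderiv_within_diff[OF U f h, of x j] nderiv_within_diff[OF U f g, of x j]
      nderiv_within_diff[OF U g h, of x j]
      Cinf_seminorm_le[OF K diff[OF f g] that, of j] Cinf_seminorm_le[OF K diff[OF g h] that, of j]
    by simp
  then show ?thesis
    unfolding Cinf_seminorm_def[of K j "\<lambda>x. f x - h x"] by (rule cSUP_least[OF K(2)])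
qed

text \<open>Deliberately mixed: closedness refers to the smooth topology, approximation to Schwartz
  seminorms. In this form the closed range among smooth functions applies to a Schwartz
  limit.\<close>

lemma closedin_Cinf_topologyD:
  assumes closed: "closedin Cinf_topology A" and v: "schwartz_on UNIV v"
    and approx: "\<And>k e. e > 0 \<Longrightarrow> \<exists>a\<in>A. schwartz_on UNIV a \<and> schwartz_seminorm UNIV k (\<lambda>x. a x - v x) < e"
  shows "v \<in> A"
proof (rule closedin_seminorm_topologyD[OF topspace_Cinf[unfolded Cinf_topology_def]
      _ closed[unfolded Cinf_topology_def]])
  show "v \<in> Cinf" using v by (simp add: Cinf_def schwartz_onD)
next
  fix Q and e :: real
  assume Q: "finite Q" "Q \<subseteq> {Cinf_seminorm K j |K j. compact K \<and> K \<noteq> {}}" "e > 0"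
  then have "Q \<subseteq> (\<lambda>(K, j). Cinf_seminorm K j) ` {(K, j). compact K \<and> K \<noteq> {}}" by fastforce
  from finite_subset_image[OF Q(1) this]
  obtain N where N: "finite N" "N \<subseteq> {(K, j). compact K \<and> K \<noteq> {}}"
      "Q = (\<lambda>(K, j). Cinf_seminorm K j) ` N"
    by blast
  define k where "k = Max (insert 0 (snd ` N))"
  obtain a where a: "a \<in> A" "schwartz_on UNIV a" "schwartz_seminorm UNIV k (\<lambda>x. a x - v x) < e"
    using approx[OF Q(3)] by blast
  have "Cinf_seminorm K j (\<lambda>x. a x - v x) < e" if "(K, j) \<in> N" for K j
  proof -
    have "j \<le> k" unfolding k_def using that N(1) by (intro Max_ge) force+
    moreover have "K \<noteq> {}" using that N(2) by auto
    ultimately show ?thesis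
      using Cinf_seminorm_le_schwartz_seminorm[OF _ schwartz_on_diff[OF closed_unbounded_interval_UNIV a(2) v], of K j k]
        a(3) by linarith
  qed
  then show "\<exists>a\<in>A. \<forall>p\<in>Q. p (\<lambda>x. a x - v x) < e"
    using a(1) N(3) by (intro bexI[of _ a]) auto
qed (auto simp: Cinf_def intro!: Cinf_seminorm_triangle)

section \<open>Smooth cutoff functions\<close>

text \<open>The polynomial \<open>q\<close> makes this class of functions closed under differentiation.\<close>

definition flat :: "real poly \<Rightarrow> real \<Rightarrow> real" where
  "flat q x = (if x > 0 then poly q (1 / x) * exp (- (1 / x)) else 0)"

text \<open>The power \<open>t ^ i\<close> is \<open>fact i\<close> times one term of the
  exponential series, which explains the factorials in the constant.\<close>

lemma poly_le_exp:
  fixes q :: "real poly"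
  shows "\<exists>K\<ge>0. \<forall>t\<ge>0. \<bar>poly q t\<bar> \<le> K * exp t"
proof (intro exI conjI allI impI)
  let ?K = "\<Sum>i\<le>degree q. \<bar>coeff q i\<bar> * fact i"
  show "?K \<ge> 0" by (intro sum_nonneg) auto
  fix t :: real assume t: "t \<ge> 0"
  have "t ^ i \<le> fact i * exp t" for i
  proof -
    have "(\<lambda>n. t ^ n /\<^sub>R fact n) sums exp t" by (rule exp_converges)
    then have "t ^ i /\<^sub>R fact i \<le> exp t"
      using sum_le_suminf[of "\<lambda>n. t ^ n /\<^sub>R fact n" "{i}"] t by (auto simp: sums_iff)
    then show ?thesis by (simp add: field_simps)
  qed
  then have "\<bar>coeff q i * t ^ i\<bar> \<le> \<bar>coeff q i\<bar> * (fact i * exp t)" for i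
    using t by (simp add: abs_mult mult_left_mono)
  then have "\<bar>poly q t\<bar> \<le> (\<Sum>i\<le>degree q. \<bar>coeff q i\<bar> * (fact i * exp t))"
    unfolding poly_altdef by (rule order_trans[OF sum_abs sum_mono])
  then show "\<bar>poly q t\<bar> \<le> ?K * exp t" by (simp add: sum_distrib_right mult.assoc)
qed

text \<open>For positive \<open>x\<close> this is the chain rule, with \<open>[:0, 0, 1:]\<close>
  supplying the factor 1/x^2. At 0 the exponential beats every polynomial in 1/x, and a quadratic
  bound makes the difference quotient vanish.\<close>

lemma flat_has_derivative:
  "(flat q has_real_derivative flat ([:0, 0, 1:] * (q - pderiv q)) x) (at x)"
proof -
  consider "x > 0" | "x < 0" | "x = 0" by linarith
  then show ?thesis
  proof cases
    case 1
    have *: "((\<lambda>x. poly q (1 / x) * exp (- (1 / x))) has_real_derivative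
          poly (pderiv q) (1 / x) * (- (1 / x\<^sup>2)) * exp (- (1 / x))
          + exp (- (1 / x)) * (1 / x\<^sup>2) * poly q (1 / x)) (at x)"
    proof -
      have "((\<lambda>x. 1 / x) has_real_derivative - (1 / x\<^sup>2)) (at x)"
        using DERIV_inverse[of x UNIV] 1 by (simp add: inverse_eq_divide power2_eq_square)
      moreover from DERIV_chain2[OF DERIV_exp DERIV_minus[OF this]]
      have "((\<lambda>x. exp (- (1 / x))) has_real_derivative exp (- (1 / x)) * (1 / x\<^sup>2)) (at x)"
        by simp
      ultimately show ?thesis
        by (intro DERIV_mult DERIV_chain2[OF poly_DERIV]) auto
    qed
    have "flat ([:0, 0, 1:] * (q - pderiv q)) x =
        poly (pderiv q) (1 / x) * (- (1 / x\<^sup>2)) * exp (- (1 / x))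
          + exp (- (1 / x)) * (1 / x\<^sup>2) * poly q (1 / x)"
      using 1 by (simp add: flat_def power2_eq_square algebra_simps)
    then show ?thesis
      using has_field_derivative_transform_within_open[OF *, of "{0<..}" "flat q"] 1 by (simp add: flat_def)
  next
    case 2
    have "((\<lambda>x. 0) has_real_derivative 0) (at x)" by simp
    then show ?thesis
      using has_field_derivative_transform_within_open[of "\<lambda>x. 0" 0 x "{..<0}" "flat q"] 2
      by (simp add: flat_def)
  next
    case 3
    obtain K where K: "K \<ge> 0" "\<And>t. t \<ge> 0 \<Longrightarrow> \<bar>poly ([:0, 0, 1:] * q) t\<bar> \<le> K * exp t"
      using poly_le_exp by metis
    \<comment> \<open>The factor h^2 is gained by applying the exponential bound to t^2 q(t) at t =
      1/h instead of to q.\<close>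
    have "\<bar>flat q h\<bar> \<le> K * h\<^sup>2" for h
    proof (cases "h > 0")
      case True
      have "poly q (1 / h) = poly ([:0, 0, 1:] * q) (1 / h) * h\<^sup>2"
        using True by (simp add: power2_eq_square)
      then have "\<bar>poly q (1 / h)\<bar> = \<bar>poly ([:0, 0, 1:] * q) (1 / h)\<bar> * h\<^sup>2"
        by (simp only: abs_mult abs_power2)
      also have "\<dots> \<le> K * exp (1 / h) * h\<^sup>2"
        using K(2)[of "1 / h"] True by (intro mult_right_mono) auto
      finally have "\<bar>poly q (1 / h)\<bar> \<le> K * exp (1 / h) * h\<^sup>2" .
      then have "\<bar>poly q (1 / h)\<bar> * exp (- (1 / h)) \<le> K * exp (1 / h) * h\<^sup>2 * exp (- (1 / h))"
        by (rule mult_right_mono) simp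
      then show ?thesis
        using True by (simp add: flat_def abs_mult exp_minus field_simps)
    qed (use K(1) in \<open>simp add: flat_def\<close>)
    then have "\<bar>flat q h\<bar> \<le> K * \<bar>h\<bar> * \<bar>h\<bar>" for h
      by (simp add: power2_eq_square mult.assoc)
    then have *: "\<bar>flat q h / h\<bar> \<le> K * \<bar>h\<bar>" for h
      by (cases "h = 0") (simp_all add: pos_divide_le_eq)
    have "((\<lambda>h. flat q h / h) \<longlongrightarrow> 0) (at 0)"
    proof (rule Lim_null_comparison)
      show "\<forall>\<^sub>F h in at 0. norm (flat q h / h) \<le> K * \<bar>h\<bar>"
        using * by (auto intro!: always_eventually)
      show "((\<lambda>h. K * \<bar>h\<bar>) \<longlongrightarrow> 0) (at 0)"
        by (auto intro!: tendsto_eq_intros)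
    qed
    then show ?thesis using 3 by (simp add: DERIV_def flat_def)
  qed
qed

lemma smooth_on_flat: "smooth_on UNIV (flat q)"
proof -
  have "has_derivs UNIV (flat q) (\<lambda>n. flat (((\<lambda>q. [:0, 0, 1:] * (q - pderiv q)) ^^ n) q))"
    using flat_has_derivative by (intro has_derivsI) auto
  then show ?thesis by (rule has_derivs_imp_smooth_on[OF closed_unbounded_interval_UNIV])
qed

lemma smooth_on_affine:
  assumes "smooth_on UNIV f"
  shows "smooth_on UNIV (\<lambda>x. f (a * x + b))"
  using has_derivs_imp_smooth_on[OF closed_unbounded_interval_UNIV
      has_derivs_affine[OF has_derivs_nderiv_within[OF assms]]] .

lemma ex_smooth_bump:
  "\<exists>f. smooth_on UNIV f \<and> (\<forall>x. 0 < x \<and> x < 1 \<longrightarrow> f x > 0) \<and> (\<forall>x. x \<le> 0 \<or> 1 \<le> x \<longrightarrow> f x = 0)"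
proof (intro exI conjI)
  let ?f = "\<lambda>x. flat 1 x * flat 1 ((-1) * x + 1)"
  show "smooth_on UNIV ?f"
    by (intro smooth_on_mult closed_unbounded_interval_UNIV smooth_on_flat smooth_on_affine)
qed (auto simp: flat_def)

text \<open>The normalised antiderivative of a bump supported in [0, 1]. The clause on the
  derivative, including the two endpoints, serves \<open>regular_values_dense\<close>.\<close>

lemma ex_smooth_step:
  "\<exists>G. smooth_on UNIV G \<and> (\<forall>x\<le>0. G x = (0::real)) \<and> (\<forall>x\<ge>1. G x = 1) \<and>
     (\<forall>x. x \<le> 0 \<or> 1 \<le> x \<longrightarrow> (G has_real_derivative 0) (at x))"
proof -
  obtain f where f: "smooth_on UNIV f" "\<And>x. 0 < x \<Longrightarrow> x < 1 \<Longrightarrow> f x > 0"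
      "\<And>x. x \<le> 0 \<or> 1 \<le> x \<Longrightarrow> f x = (0::real)"
    using ex_smooth_bump by auto
  note der = has_derivs_nderiv_within[OF f(1)]
  have cont: "continuous_on A f" for A
    using continuous_on_nderiv_within[OF f(1), of 0] continuous_on_subset by auto
  \<comment> \<open>Starting at -1, left of the support, lets two cases overlap: the fundamental
    theorem of calculus for x > -1, and \<open>F = 0\<close> on the negative axis.\<close>
  define F where "F x = integral {-1..x} f" for x
  have F0: "F x = 0" if "x \<le> 0" for x
  proof -
    have "integral {-1..x} f = integral {-1..x} (\<lambda>x. 0)"
      using that f(3) by (intro integral_cong) auto
    then show ?thesis by (simp add: F_def)
  qed
  have F': "(F has_real_derivative f x) (at x)" for x
  proof (cases "x > -1")
    case True
    have "(F has_real_derivative f x) (at x within {-1..x + 1})"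
      unfolding F_def using integral_has_real_derivative[OF cont, of x "-1" "x + 1"] True by simp
    then show ?thesis using True by (simp add: at_within_Icc_at)
  next
    case False
    have "((\<lambda>x. 0) has_real_derivative 0) (at x)" by simp
    then show ?thesis
      using has_field_derivative_transform_within_open[of "\<lambda>x. 0" 0 x "{..<0}" F] False F0 f(3)[of x]
      by simp
  qed
  have smooth: "has_derivs UNIV F (\<lambda>n. case n of 0 \<Rightarrow> F | Suc n \<Rightarrow> nderiv_within UNIV n f)"
    using F' has_derivs_Suc[OF der]
    by (intro has_derivsI) (auto split: nat.split)
  have "F 0 < F 1"
    by (rule DERIV_pos_imp_increasing_open)
       (use F' f(2) in \<open>auto intro!: DERIV_continuous_on intro: has_field_derivative_at_within\<close>)
  then have pos: "F 1 > 0" using F0[of 0] by simp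
  have F1: "F x = F 1" if "x \<ge> 1" for x
  proof -
    have "\<exists>c. \<forall>x\<in>{1..}. F x = c"
    proof (rule has_field_derivative_zero_constant)
      fix x :: real assume "x \<in> {1..}"
      then show "(F has_real_derivative 0) (at x within {1..})"
        using has_field_derivative_at_within[OF F', of x "{1..}"] f(3)[of x] by simp
    qed simp
    then show ?thesis using that by auto
  qed
  show ?thesis
  proof (intro exI conjI)
    show "smooth_on UNIV (\<lambda>x. inverse (F 1) * F x)"
      by (intro smooth_on_cmult closed_unbounded_interval_UNIV has_derivs_imp_smooth_on[OF _ smooth])
    show "\<forall>x. x \<le> 0 \<or> 1 \<le> x \<longrightarrow> ((\<lambda>x. inverse (F 1) * F x) has_real_derivative 0) (at x)"
    proof (intro allI impI)
      fix x :: real assume "x \<le> 0 \<or> 1 \<le> x"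
      then show "((\<lambda>x. inverse (F 1) * F x) has_real_derivative 0) (at x)"
        using DERIV_cmult[OF F', of "inverse (F 1)" x] f(3)[of x] by simp
    qed
    show "\<forall>x\<le>0. inverse (F 1) * F x = 0" using F0 by simp
    show "\<forall>x\<ge>1. inverse (F 1) * F x = 1"
    proof (intro allI impI)
      fix x :: real assume "x \<ge> 1"
      show "inverse (F 1) * F x = 1" unfolding F1[OF \<open>x \<ge> 1\<close>] using pos by simp
    qed
  qed
qed

text \<open>Continuity on a compact interval supplies the bounds near the origin; bounds for
  separate \<open>j\<close> are merged by a finite maximum over \<open>j \<le> n\<close>.\<close>

lemma schwartz_onI_infinity:
  assumes f: "smooth_on UNIV f"
    and bound: "\<And>n j. \<exists>B R. \<forall>x. R < \<bar>x\<bar> \<longrightarrow> (1 + x\<^sup>2) ^ n * \<bar>nderiv_within UNIV j f x\<bar> \<le> B"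
  shows "schwartz_on UNIV f"
proof -
  have "\<exists>B. \<forall>x. (1 + x\<^sup>2) ^ n * \<bar>nderiv_within UNIV j f x\<bar> \<le> B" for n j
  proof -
    obtain B R where BR: "\<And>x. R < \<bar>x\<bar> \<Longrightarrow> (1 + x\<^sup>2) ^ n * \<bar>nderiv_within UNIV j f x\<bar> \<le> B"
      using bound by blast
    have "continuous_on {-R..R} (\<lambda>x. (1 + x\<^sup>2) ^ n * \<bar>nderiv_within UNIV j f x\<bar>)"
      using continuous_on_nderiv_within[OF f, of j] by (intro continuous_intros) (auto intro: continuous_on_subset)
    then have "bounded ((\<lambda>x. (1 + x\<^sup>2) ^ n * \<bar>nderiv_within UNIV j f x\<bar>) ` {-R..R})"
      by (intro compact_imp_bounded compact_continuous_image) auto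
    then obtain M where M: "\<And>x. x \<in> {-R..R} \<Longrightarrow> (1 + x\<^sup>2) ^ n * \<bar>nderiv_within UNIV j f x\<bar> \<le> M"
      unfolding bounded_iff by (auto simp: abs_mult intro: that)
    have "(1 + x\<^sup>2) ^ n * \<bar>nderiv_within UNIV j f x\<bar> \<le> max B M" for x
      using BR[of x] M[of x] by (cases "R < \<bar>x\<bar>") (auto simp: le_max_iff_disj abs_le_iff not_less)
    then show ?thesis by blast
  qed
  then obtain B where B: "\<And>n j x. (1 + x\<^sup>2) ^ n * \<bar>nderiv_within UNIV j f x\<bar> \<le> B n j" by metis
  have "(1 + x\<^sup>2) ^ n * \<bar>nderiv_within UNIV j f x\<bar> \<le> Max (B n ` {..n})" if "j \<le> n" for n j x
    using order_trans[OF B[of x n j] Max_ge[of "B n ` {..n}" "B n j"]] that by simp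
  then show ?thesis using f unfolding schwartz_on_def by blast
qed

lemma nderiv_within_eq_zero:
  assumes "closed_unbounded_interval I" "smooth_on I f" "open U" "\<And>x. x \<in> U \<inter> I \<Longrightarrow> f x = 0" "x \<in> U \<inter> I"
  shows "nderiv_within I n f x = 0"
  using nderiv_within_local[OF assms(1,2) schwartz_onD(1)[OF schwartz_on_zero[OF assms(1)]] assms(3-5)]
    nderiv_within_zero[OF assms(1)] assms(5) by simp

lemma schwartz_on_compact_support:
  assumes "smooth_on UNIV f" "\<And>x. R < \<bar>x\<bar> \<Longrightarrow> f x = 0"
  shows "schwartz_on UNIV f"
proof (rule schwartz_onI_infinity[OF assms(1)])
  fix n j
  have "open {x::real. R < \<bar>x\<bar>}" by (intro open_Collect_less continuous_intros)
  then have "nderiv_within UNIV j f x = 0" if "R < \<bar>x\<bar>" for x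
    by (rule nderiv_within_eq_zero[OF closed_unbounded_interval_UNIV assms(1)]) (use assms(2) that in auto)
  then show "\<exists>B R. \<forall>x. R < \<bar>x\<bar> \<longrightarrow> (1 + x\<^sup>2) ^ n * \<bar>nderiv_within UNIV j f x\<bar> \<le> B"
    by (intro exI[of _ 0] exI[of _ R]) simp
qed

lemma ex_schwartz_bump:
  "\<exists>f. schwartz_on UNIV f \<and> (\<forall>x\<in>{a..b}. f x = 1)" for a b :: real
proof -
  obtain G where G: "smooth_on UNIV G" "\<And>x. x \<le> 0 \<Longrightarrow> G x = (0::real)" "\<And>x. x \<ge> 1 \<Longrightarrow> G x = 1"
    using ex_smooth_step by blast
  let ?f = "\<lambda>x. G (1 * x + (1 - a)) * G ((-1) * x + (b + 1))"
  have "smooth_on UNIV ?f"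
    by (intro smooth_on_mult closed_unbounded_interval_UNIV smooth_on_affine G)
  then have "schwartz_on UNIV ?f"
    \<comment> \<open>The two factors vanish for x \<le> a - 1 and for x \<ge> b + 1
      respectively.\<close>
    by (rule schwartz_on_compact_support[where R="\<bar>a\<bar> + \<bar>b\<bar> + 1"])
       (auto simp: abs_if not_less split: if_splits intro!: G(2))
  then show ?thesis by (intro exI[of _ ?f]) (auto simp: G(3))
qed

section \<open>Multiplication operators\<close>

text \<open>Uniform boundedness of the functionals \<open>\<bar>h x * f x\<bar>\<close> replaces the
  closed graph theorem. Testing the resulting estimate on a bump translated to \<open>x\<close>
  bounds \<open>h x\<close> by a seminorm of the translate, which grows polynomially in
  \<open>x\<close>.\<close>

lemma multiplier_growth:
  assumes I: "closed_unbounded_interval I"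
    and mult: "\<And>f. schwartz_on I f \<Longrightarrow> schwartz_on I (\<lambda>x. h x * f x)"
  shows "\<exists>C\<ge>0. \<exists>k. \<forall>x\<in>I. \<bar>h x\<bar> \<le> C * (1 + x\<^sup>2) ^ k"
proof -
  have "\<exists>C\<ge>0. \<exists>k. \<forall>x\<in>I. \<forall>f\<in>Collect (schwartz_on I). \<bar>h x * f x\<bar> \<le> C * schwartz_seminorm I k f"
  proof (rule uniform_boundedness_seminorms[where p="schwartz_seminorm I"])
    fix g assume "\<And>n::nat. g n \<in> Collect (schwartz_on I)" "\<And>n. schwartz_seminorm I n (g n) \<le> (1/2) ^ n"
    then show "\<exists>h\<in>Collect (schwartz_on I).
        \<forall>k. (\<lambda>N. schwartz_seminorm I k (\<lambda>x. h x - (\<Sum>i<N. g i x))) \<longlonglongrightarrow> 0"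
      using schwartz_on_series[OF I, of g] by auto
  next
    fix x assume "x \<in> I"
    then have "\<bar>h x * f x\<bar> \<le> \<bar>h x\<bar> * schwartz_seminorm I 0 f" if "schwartz_on I f" for f
      using nderiv_within_le_schwartz_seminorm[OF I that, of x 0 0] by (simp add: abs_mult mult_left_mono)
    then show "\<exists>C k. \<forall>f\<in>Collect (schwartz_on I). \<bar>h x * f x\<bar> \<le> C * schwartz_seminorm I k f" by blast
  next
    fix f assume f: "f \<in> Collect (schwartz_on I)"
    then show "\<exists>B. \<forall>x\<in>I. \<bar>h x * f x\<bar> \<le> B"
      using nderiv_within_le_schwartz_seminorm[OF I mult, of f _ 0 0] by auto
  next
    fix x and f g :: "real \<Rightarrow> real"
    show "\<bar>h x * (f x + g x)\<bar> \<le> \<bar>h x * f x\<bar> + \<bar>h x * g x\<bar>"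
      by (simp only: distrib_left abs_triangle_ineq)
  qed (use schwartz_on_zero[OF I] schwartz_on_add[OF I] schwartz_on_cmult[OF I]
      schwartz_seminorm_nonneg[OF I] schwartz_seminorm_mono[OF I] schwartz_seminorm_cmult[OF I]
      in \<open>auto simp: abs_mult\<close>)
  then obtain C k where C: "C \<ge> 0" "\<And>x f. x \<in> I \<Longrightarrow> schwartz_on I f \<Longrightarrow> \<bar>h x * f x\<bar> \<le> C * schwartz_seminorm I k f"
    by auto
  note U = closed_unbounded_interval_UNIV
  obtain b where b: "schwartz_on UNIV b" "b 0 = 1"
    using ex_schwartz_bump[of 0 0] by auto
  have "\<bar>h x\<bar> \<le> (C * 2 ^ k * schwartz_seminorm UNIV k b) * (1 + x\<^sup>2) ^ k" if x: "x \<in> I" for x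
  proof -
    define f where "f t = b (1 * t + - x)" for t
    have smooth: "smooth_on UNIV f"
      unfolding f_def by (intro smooth_on_affine schwartz_onD b)
    have deriv: "nderiv_within I j f t = nderiv_within UNIV j b (t - x)" if "t \<in> I" for j t
      using nderiv_within_restriction[OF I smooth that, of j]
        nderiv_within_eq[OF U has_derivs_affine[OF has_derivs_nderiv_within[OF schwartz_onD(1)[OF b(1)]], of 1 "-x"], of t j]
      by (simp add: f_def[abs_def])
    have bound: "(1 + t\<^sup>2) ^ k * \<bar>nderiv_within I j f t\<bar> \<le> (2 * (1 + x\<^sup>2)) ^ k * schwartz_seminorm UNIV k b"
      if "t \<in> I" "j \<le> k" for t j k
    proof -
      \<comment> \<open>Peetre's inequality 1 + t^2 \<le> 2 (1 + x^2) (1 + (t - x)^2), with the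
        difference of the two sides written as a sum of squares.\<close>
      have "2 * (1 + x\<^sup>2) * (1 + (t - x)\<^sup>2) - (1 + t\<^sup>2) = 1 + (t - 2 * x)\<^sup>2 + 2 * x\<^sup>2 * (t - x)\<^sup>2"
        by (simp add: power2_eq_square algebra_simps)
      then have "1 + t\<^sup>2 \<le> 2 * (1 + x\<^sup>2) * (1 + (t - x)\<^sup>2)"
        by (smt (verit) mult_nonneg_nonneg zero_le_power2)
      then have "(1 + t\<^sup>2) ^ k \<le> (2 * (1 + x\<^sup>2)) ^ k * (1 + (t - x)\<^sup>2) ^ k"
        by (metis power_mono power_mult_distrib add_nonneg_nonneg zero_le_one zero_le_power2)
      then have "(1 + t\<^sup>2) ^ k * \<bar>nderiv_within I j f t\<bar>
          \<le> (2 * (1 + x\<^sup>2)) ^ k * (1 + (t - x)\<^sup>2) ^ k * \<bar>nderiv_within UNIV j b (t - x)\<bar>"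
        using deriv[OF that(1)] by (simp add: mult_right_mono)
      also have "\<dots> \<le> (2 * (1 + x\<^sup>2)) ^ k * schwartz_seminorm UNIV k b"
        unfolding mult.assoc using schwartz_seminorm_ge[OF U b(1) _ that(2), of "t - x"]
        by (intro mult_left_mono) auto
      finally show ?thesis .
    qed
    have f: "schwartz_on I f"
      unfolding schwartz_on_def using smooth_on_restriction[OF I smooth] bound by blast
    have "\<bar>h x\<bar> \<le> C * schwartz_seminorm I k f"
      using C(2)[OF x f] by (simp add: f_def b)
    also have "C * schwartz_seminorm I k f \<le> C * ((2 * (1 + x\<^sup>2)) ^ k * schwartz_seminorm UNIV k b)"
    proof (rule mult_left_mono[OF _ C(1)])
      show "schwartz_seminorm I k f \<le> (2 * (1 + x\<^sup>2)) ^ k * schwartz_seminorm UNIV k b"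
        unfolding schwartz_seminorm_le_iff[OF I f] using bound by blast
    qed
    finally show ?thesis by (simp only: power_mult_distrib mult_ac)
  qed
  moreover have "0 \<le> C * 2 ^ k * schwartz_seminorm UNIV k b"
    using C(1) schwartz_seminorm_nonneg[OF U b(1)] by simp
  ultimately show ?thesis by blast
qed

text \<open>The Leibniz rule is solved for the j-th derivative of \<open>v\<close>, the lower ones
  being known by induction. The constant involves 1/|h x|, so it may blow up near zeros of
  \<open>h\<close>; here only continuity of each single functional is obtained.\<close>

lemma division_estimate_at_point:
  assumes I: "closed_unbounded_interval I" and h: "smooth_on I h"
    and mult: "\<And>f. schwartz_on I f \<Longrightarrow> schwartz_on I (\<lambda>x. h x * f x)"
    and x: "x \<in> I" "h x \<noteq> 0"
  shows "\<exists>C\<ge>0. \<exists>k. \<forall>v. schwartz_on I v \<longrightarrow>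
     \<bar>nderiv_within I j v x\<bar> \<le> C * schwartz_seminorm I k (\<lambda>x. h x * v x)"
proof (induction j rule: less_induct)
  case (less j)
  then have "\<forall>i\<in>{..<j}. \<exists>C k. C \<ge> 0 \<and> (\<forall>v. schwartz_on I v \<longrightarrow>
     \<bar>nderiv_within I i v x\<bar> \<le> C * schwartz_seminorm I k (\<lambda>x. h x * v x))" by blast
  then obtain C K where CK: "\<And>i v. i < j \<Longrightarrow> C i \<ge> 0" "\<And>i v. i < j \<Longrightarrow> schwartz_on I v \<Longrightarrow>
     \<bar>nderiv_within I i v x\<bar> \<le> C i * schwartz_seminorm I (K i) (\<lambda>x. h x * v x)"
    by (metis lessThan_iff)
  obtain c where c: "\<And>E. prod_derivs j (\<lambda>n. nderiv_within I n h) E x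
      = h x * E j x + (\<Sum>i<j. c i * E i x)"
    using prod_derivs_leading_term[of j "\<lambda>n. nderiv_within I n h" x] by auto
  define k where "k = Max (insert j (K ` {..<j}))"
  have k: "j \<le> k" "\<And>i. i < j \<Longrightarrow> K i \<le> k"
    unfolding k_def by (auto intro!: Max_ge)
  define B where "B = (1 + (\<Sum>i<j. \<bar>c i\<bar> * C i)) / \<bar>h x\<bar>"
  have "\<bar>nderiv_within I j v x\<bar> \<le> B * schwartz_seminorm I k (\<lambda>x. h x * v x)"
    if v: "schwartz_on I v" for v
  proof -
    define S where "S = schwartz_seminorm I k (\<lambda>x. h x * v x)"
    have "nderiv_within I j (\<lambda>x. h x * v x) x
        = h x * nderiv_within I j v x + (\<Sum>i<j. c i * nderiv_within I i v x)"
      using nderiv_within_eq[OF I has_derivs_mult[OF has_derivs_nderiv_within[OF h]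
            has_derivs_nderiv_within[OF schwartz_onD(1)[OF v]]] x(1), of j] c by simp
    then have eq: "h x * nderiv_within I j v x
        = nderiv_within I j (\<lambda>x. h x * v x) x - (\<Sum>i<j. c i * nderiv_within I i v x)" by simp
    have "\<bar>nderiv_within I j (\<lambda>x. h x * v x) x\<bar> \<le> S"
      unfolding S_def by (rule nderiv_within_le_schwartz_seminorm[OF I mult[OF v] x(1) k(1)])
    moreover have "\<bar>\<Sum>i<j. c i * nderiv_within I i v x\<bar> \<le> (\<Sum>i<j. \<bar>c i\<bar> * C i) * S"
    proof -
      have "\<bar>c i * nderiv_within I i v x\<bar> \<le> \<bar>c i\<bar> * C i * S" if "i < j" for i
      proof -
        have "C i * schwartz_seminorm I (K i) (\<lambda>x. h x * v x) \<le> C i * S"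
          unfolding S_def using CK(1) that k by (intro mult_left_mono schwartz_seminorm_mono I mult v) auto
        then have "\<bar>nderiv_within I i v x\<bar> \<le> C i * S" using CK(2)[OF that v] by linarith
        then show ?thesis by (simp add: abs_mult mult.assoc mult_left_mono)
      qed
      then show ?thesis
        unfolding sum_distrib_right by (intro order_trans[OF sum_abs sum_mono]) auto
    qed
    ultimately have "\<bar>h x\<bar> * \<bar>nderiv_within I j v x\<bar> \<le> (1 + (\<Sum>i<j. \<bar>c i\<bar> * C i)) * S"
      unfolding abs_mult[symmetric] eq by (simp add: distrib_right)
    then show ?thesis
      unfolding B_def S_def[symmetric] using x(2) by (simp add: field_simps)
  qed
  moreover have "B \<ge> 0"
    unfolding B_def using CK(1) by (intro divide_nonneg_nonneg add_nonneg_nonneg sum_nonneg mult_nonneg_nonneg) auto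
  ultimately show ?case by blast
qed

text \<open>The open mapping theorem for multiplication by \<open>h\<close>, restricted to the set where
  \<open>h\<close> does not vanish, so that injectivity is not required.\<close>

lemma division_estimate:
  assumes I: "closed_unbounded_interval I" and h: "smooth_on I h"
    and mult: "\<And>f. schwartz_on I f \<Longrightarrow> schwartz_on I (\<lambda>x. h x * f x)"
    and closed: "closedin (schwartz_topology I) (mult_op I h ` schwartz I)"
  shows "\<exists>C\<ge>0. \<exists>k. \<forall>v. schwartz_on I v \<longrightarrow> (\<forall>x\<in>I. h x \<noteq> 0 \<longrightarrow> (\<forall>j\<le>m.
     (1 + x\<^sup>2) ^ m * \<bar>nderiv_within I j v x\<bar> \<le> C * schwartz_seminorm I k (\<lambda>x. h x * v x)))"
proof -
  \<comment> \<open>S(I) carries the seminorms of the product; completeness for these is where the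
    closed range enters.\<close>
  define p where "p k v = schwartz_seminorm I k (\<lambda>x. h x * v x)" for k v
  define q where "q = (\<lambda>(x, j) v. (1 + x\<^sup>2) ^ m * \<bar>nderiv_within I j v x\<bar>)"
  \<comment> \<open>At these points the evaluations of derivatives are continuous for
    \<open>p\<close>, by \<open>division_estimate_at_point\<close>.\<close>
  define J where "J = {x\<in>I. h x \<noteq> 0} \<times> {..m}"
  have "\<exists>C\<ge>0. \<exists>k. \<forall>a\<in>J. \<forall>v\<in>Collect (schwartz_on I). q a v \<le> C * p k v"
  proof (rule uniform_boundedness_seminorms[where p=p])
    fix g assume g: "\<And>n::nat. g n \<in> Collect (schwartz_on I)" "\<And>n. p n (g n) \<le> (1/2) ^ n"
    then have gs: "schwartz_on I (g n)" for n by simp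
    obtain G where G: "schwartz_on I G"
      "\<And>k. (\<lambda>N. schwartz_seminorm I k (\<lambda>x. G x - (\<Sum>i<N. h x * g i x))) \<longlonglongrightarrow> 0"
      using schwartz_on_series[OF I, of "\<lambda>n x. h x * g n x"] mult[OF gs] g(2) unfolding p_def by blast
    define S where "S N x = (\<Sum>i<N. g i x)" for N x
    have S: "schwartz_on I (S N)" for N unfolding S_def by (intro schwartz_on_sum I gs)
    have G': "(\<lambda>N. schwartz_seminorm I k (\<lambda>x. G x - h x * S N x)) \<longlonglongrightarrow> 0" for k
      using G(2)[of k] by (simp add: S_def sum_distrib_left)
    \<comment> \<open>The limit \<open>G\<close> of the products lies in the closed range, so it is
      \<open>h\<close> times some \<open>v\<close>. The partial sums converge to \<open>v\<close> in
      the seminorms \<open>p\<close>; convergence in S(I) itself is not claimed.\<close>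
    have "restrict G I \<in> mult_op I h ` schwartz I"
    proof (rule closedin_schwartz_topologyD[OF I closed])
      show "restrict G I \<in> schwartz I" using G(1) by (simp add: restrict_in_schwartz_iff[OF I])
      fix k and e :: real assume "e > 0"
      then obtain N where N: "schwartz_seminorm I k (\<lambda>x. G x - h x * S N x) < e"
        using order_tendstoD(2)[OF G'[of k]] eventually_happens' sequentially_bot by blast
      let ?a = "mult_op I h (restrict (S N) I)"
      have "schwartz_seminorm I k (\<lambda>x. ?a x - restrict G I x) = schwartz_seminorm I k (\<lambda>x. h x * S N x - G x)"
        by (rule schwartz_seminorm_cong[OF I schwartz_on_diff[OF I mult[OF S] G(1)]]) (simp add: mult_op_def)
      also have "\<dots> < e" using N schwartz_seminorm_minus_commute[OF I mult[OF S] G(1)] by simp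
      finally show "\<exists>a\<in>mult_op I h ` schwartz I. schwartz_seminorm I k (\<lambda>x. a x - restrict G I x) < e"
        using S restrict_in_schwartz_iff[OF I] by blast
    qed
    then obtain v where v: "v \<in> schwartz I" "restrict G I = mult_op I h v" by blast
    have Gv: "G x = h x * v x" if "x \<in> I" for x
      using fun_cong[OF v(2), of x] that by (simp add: mult_op_def)
    have vs: "schwartz_on I v" using v(1) by (simp add: schwartz_iff)
    have "p k (\<lambda>x. v x - S N x) = schwartz_seminorm I k (\<lambda>x. G x - h x * S N x)" for k N
      unfolding p_def
      by (rule schwartz_seminorm_cong[OF I schwartz_on_diff[OF I G(1) mult[OF S]]])
         (simp add: Gv algebra_simps)
    then show "\<exists>v\<in>Collect (schwartz_on I). \<forall>k. (\<lambda>N. p k (\<lambda>x. v x - (\<Sum>i<N. g i x))) \<longlonglongrightarrow> 0"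
      using G' vs by (intro bexI[of _ v]) (auto simp: S_def)
  next
    fix a assume a: "a \<in> J"
    obtain x j where xj: "a = (x, j)" by (cases a)
    obtain C k where C: "\<And>v. schwartz_on I v \<Longrightarrow> \<bar>nderiv_within I j v x\<bar> \<le> C * p k v"
      using division_estimate_at_point[OF I h mult, of x j] a unfolding J_def xj p_def by auto
    have "q a v \<le> ((1 + x\<^sup>2) ^ m * C) * p k v" if "schwartz_on I v" for v
      using C[OF that] unfolding q_def xj by (simp add: mult_left_mono mult.assoc)
    then show "\<exists>C k. \<forall>v\<in>Collect (schwartz_on I). q a v \<le> C * p k v" by blast
  next
    fix v assume "v \<in> Collect (schwartz_on I)"
    then show "\<exists>B. \<forall>a\<in>J. q a v \<le> B"
      using schwartz_seminorm_ge[OF I, of v] by (auto simp: J_def q_def)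
  next
    fix c k v assume v: "v \<in> Collect (schwartz_on I)"
    then show "p k (\<lambda>x. c * v x) \<le> \<bar>c\<bar> * p k v"
      using schwartz_seminorm_cmult[OF I mult, of v k c] by (simp add: p_def mult.left_commute)
  next
    fix a f g assume *: "a \<in> J" "f \<in> Collect (schwartz_on I)" "g \<in> Collect (schwartz_on I)"
    then show "q a (\<lambda>x. f x + g x) \<le> q a f + q a g"
      using weighted_add_le[OF order_refl order_refl]
      by (auto simp: J_def q_def nderiv_within_add[OF I] schwartz_onD)
  next
    fix a c f assume *: "a \<in> J" "f \<in> Collect (schwartz_on I)"
    then show "q a (\<lambda>x. c * f x) = \<bar>c\<bar> * q a f"
      by (auto simp: J_def q_def nderiv_within_cmult[OF I] schwartz_onD abs_mult)
  qed (use schwartz_on_zero[OF I] schwartz_on_add[OF I] schwartz_on_cmult[OF I] mult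
      schwartz_seminorm_nonneg[OF I] schwartz_seminorm_mono[OF I] in \<open>auto simp: p_def\<close>)
  then show ?thesis unfolding J_def q_def p_def by force
qed

section \<open>Critical values, growth and limits of derivatives\<close>

lemma schwartz_on_restriction:
  assumes "closed_unbounded_interval I" "schwartz_on UNIV f"
  shows "schwartz_on I f"
  using assms smooth_on_restriction[OF assms(1)] nderiv_within_restriction[OF assms(1)]
  unfolding schwartz_on_def by simp metis

lemma nderiv_within_nderiv_within:
  "nderiv_within I j (nderiv_within I k f) = nderiv_within I (j + k) f"
  by (simp add: nderiv_within_def funpow_add)

lemma smooth_on_nderiv_within:
  "smooth_on I f \<Longrightarrow> smooth_on I (nderiv_within I k f)"
  by (simp add: smooth_on_def nderiv_within_nderiv_within)

lemma schwartz_on_nderiv_within: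
  assumes "schwartz_on UNIV f"
  shows "schwartz_on UNIV (nderiv_within UNIV k f)"
  unfolding schwartz_on_def
proof (intro conjI allI smooth_on_nderiv_within schwartz_onD(1)[OF assms])
  fix n
  have "(1 + x\<^sup>2) ^ n * \<bar>nderiv_within UNIV j (nderiv_within UNIV k f) x\<bar> \<le> schwartz_seminorm UNIV (n + k) f"
    if "j \<le> n" for j x
  proof -
    have "(1 + x\<^sup>2) ^ n * \<bar>nderiv_within UNIV (j + k) f x\<bar> \<le> (1 + x\<^sup>2) ^ (n + k) * \<bar>nderiv_within UNIV (j + k) f x\<bar>"
      by (intro mult_right_mono power_increasing) auto
    also have "\<dots> \<le> schwartz_seminorm UNIV (n + k) f"
      by (rule schwartz_seminorm_ge[OF closed_unbounded_interval_UNIV assms]) (use that in auto)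
    finally show ?thesis by (simp add: nderiv_within_nderiv_within)
  qed
  then show "\<exists>B. \<forall>x\<in>UNIV. \<forall>j\<le>n. (1 + x\<^sup>2) ^ n * \<bar>nderiv_within UNIV j (nderiv_within UNIV k f) x\<bar> \<le> B"
    by blast
qed

lemma DERIV_nderiv_within:
  assumes "smooth_on UNIV f"
  shows "(nderiv_within UNIV n f has_real_derivative nderiv_within UNIV (Suc n) f x) (at x)"
  using has_derivs_Suc[OF has_derivs_nderiv_within[OF assms], of x n] by simp

lemma DERIV_smooth_on:
  assumes "smooth_on UNIV f"
  shows "(f has_real_derivative deriv f x) (at x)"
  using DERIV_nderiv_within[OF assms, of 0 x] nderiv_within_1_eq_deriv[OF assms] by simp

lemma smooth_on_deriv: "smooth_on UNIV f \<Longrightarrow> smooth_on UNIV (deriv f)"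
  using smooth_on_nderiv_within[of UNIV f 1] by (simp only: nderiv_within_1_eq_deriv)

lemma nderiv_within_1_comp:
  assumes "smooth_on UNIV f" "smooth_on UNIV \<phi>"
  shows "nderiv_within UNIV 1 (f \<circ> \<phi>) x = deriv \<phi> x * nderiv_within UNIV 1 f (\<phi> x)"
proof -
  have "((f \<circ> \<phi>) has_real_derivative nderiv_within UNIV 1 f (\<phi> x) * deriv \<phi> x) (at x)"
    using DERIV_nderiv_within[OF assms(1), of 0 "\<phi> x"] DERIV_smooth_on[OF assms(2), of x]
    by (intro DERIV_chain) auto
  then show ?thesis
    using vector_derivative_within_eq[OF closed_unbounded_interval_UNIV, of x "f \<circ> \<phi>"] nderiv_within_Suc[of UNIV 0 "f \<circ> \<phi>" x]
    by simp
qed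

text \<open>A one-dimensional substitute for Sard's theorem: if every point with value strictly
  between \<open>c\<close> and \<open>d\<close> were critical, a smooth step composed with the
  rescaled \<phi> would have zero derivative on \<open>I\<close>, yet it takes both values 0 and
  1.\<close>

lemma regular_values_dense:
  assumes I: "convex I" and \<phi>: "smooth_on UNIV \<phi>"
    and "c < d" "c \<in> \<phi> ` I" "d \<in> \<phi> ` I"
  shows "\<exists>x\<in>I. deriv \<phi> x \<noteq> 0 \<and> c < \<phi> x \<and> \<phi> x < d"
proof (rule ccontr)
  assume neg: "\<not> ?thesis"
  obtain G where G: "G 0 = 0" "G 1 = 1" "\<And>x. x \<le> 0 \<or> 1 \<le> x \<Longrightarrow> (G has_real_derivative 0) (at (x::real))"
      "smooth_on UNIV G"
    using ex_smooth_step by (metis order_refl)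
  define H where "H x = G ((\<phi> x - c) / (d - c))" for x
  have "\<exists>k. \<forall>x\<in>I. H x = k"
  proof (rule has_field_derivative_zero_constant[OF I])
    fix x assume x: "x \<in> I"
    obtain D where D: "(G has_real_derivative D) (at ((\<phi> x - c) / (d - c)))"
        "\<phi> x \<le> c \<or> d \<le> \<phi> x \<Longrightarrow> D = 0"
    proof (cases "\<phi> x \<le> c \<or> d \<le> \<phi> x")
      case True
      then have "(\<phi> x - c) / (d - c) \<le> 0 \<or> 1 \<le> (\<phi> x - c) / (d - c)"
        using assms(3) by (auto simp: field_simps)
      from that[OF G(3)[OF this]] show ?thesis by simp
    next
      case False
      show ?thesis by (rule that[OF DERIV_smooth_on[OF G(4)]]) (use False in simp)
    qed
    have "((\<lambda>x. (\<phi> x - c) / (d - c)) has_real_derivative deriv \<phi> x / (d - c)) (at x)"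
      using DERIV_smooth_on[OF \<phi>, of x] assms(3) by (auto intro!: derivative_eq_intros)
    then have "(H has_real_derivative D * (deriv \<phi> x / (d - c))) (at x)"
      unfolding H_def by (rule DERIV_chain2[where f=G and g="\<lambda>x. (\<phi> x - c) / (d - c)", OF D(1)])
    moreover have "D * (deriv \<phi> x / (d - c)) = 0"
      using neg x D(2) by (auto simp: not_less)
    ultimately show "(H has_real_derivative 0) (at x within I)"
      using has_field_derivative_at_within by fastforce
  qed
  then obtain k where k: "\<And>x. x \<in> I \<Longrightarrow> H x = k" by blast
  obtain x1 x2 where "x1 \<in> I" "c = \<phi> x1" "x2 \<in> I" "d = \<phi> x2" using assms(4,5) by blast
  then have "H x1 = 0" "H x2 = 1" using G(1,2) assms(3) by (auto simp: H_def)
  then show False using k[OF \<open>x1 \<in> I\<close>] k[OF \<open>x2 \<in> I\<close>] by simp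
qed

text \<open>The mean value inequality on the segment from \<open>a\<close> to \<open>x\<close>,
  which lies in \<open>I\<close> by convexity.\<close>

lemma polynomially_bounded_if_deriv:
  assumes I: "convex I" "a \<in> I" and \<phi>: "smooth_on UNIV \<phi>"
    and C: "C \<ge> 0" "\<And>x. x \<in> I \<Longrightarrow> \<bar>deriv \<phi> x\<bar> \<le> C * (1 + x\<^sup>2) ^ k"
  shows "\<exists>K\<ge>0. \<exists>p. \<forall>x\<in>I. 1 + (\<phi> x)\<^sup>2 \<le> K * (1 + x\<^sup>2) ^ p"
proof -
  \<comment> \<open>The dependence on \<open>a\<close>: a factor (1 + a^2)^k from bounding the
    derivative along the segment, and 1 + |a| from |x - a| \<le> (1 + |a|)(1 + x^2). The last
    inequality also raises \<open>k\<close> to \<open>Suc k\<close>, and squaring doubles the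
    exponent.\<close>
  define A where "A = C * (1 + a\<^sup>2) ^ k * (1 + \<bar>a\<bar>)"
  have A: "A \<ge> 0" using C(1) by (simp add: A_def)
  have "1 + (\<phi> x)\<^sup>2 \<le> (1 + (\<bar>\<phi> a\<bar> + A)\<^sup>2) * (1 + x\<^sup>2) ^ (2 * Suc k)" if x: "x \<in> I" for x
  proof -
    let ?w = "1 + x\<^sup>2"
    have w: "1 \<le> ?w ^ n" for n by (rule one_le_power) simp
    have "norm (\<phi> x - \<phi> a) \<le> (C * ((1 + a\<^sup>2) * ?w) ^ k) * norm (x - a)"
    proof (rule field_differentiable_bound[of "closed_segment a x" \<phi> "deriv \<phi>"])
      fix z assume z: "z \<in> closed_segment a x"
      then have "z \<in> I" using I x closed_segment_subset by blast
      have "\<bar>z\<bar> \<le> max \<bar>a\<bar> \<bar>x\<bar>"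
        using z by (auto simp: closed_segment_eq_real_ivl split: if_splits)
      then have "\<bar>z\<bar> \<le> \<bar>a\<bar> \<or> \<bar>z\<bar> \<le> \<bar>x\<bar>" by linarith
      then have "z\<^sup>2 \<le> a\<^sup>2 \<or> z\<^sup>2 \<le> x\<^sup>2" by (simp add: abs_le_square_iff)
      moreover have "0 \<le> a\<^sup>2 * x\<^sup>2" "0 \<le> a\<^sup>2" "0 \<le> x\<^sup>2" by simp_all
      ultimately have "1 + z\<^sup>2 \<le> 1 + a\<^sup>2 + x\<^sup>2 + a\<^sup>2 * x\<^sup>2" by linarith
      then have "1 + z\<^sup>2 \<le> (1 + a\<^sup>2) * ?w" by (simp add: algebra_simps)
      then have "(1 + z\<^sup>2) ^ k \<le> ((1 + a\<^sup>2) * ?w) ^ k" by (intro power_mono) auto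
      then show "norm (deriv \<phi> z) \<le> C * ((1 + a\<^sup>2) * ?w) ^ k"
        using C(2)[OF \<open>z \<in> I\<close>] C(1) by (simp add: order_trans[OF _ mult_left_mono])
    qed (use DERIV_smooth_on[OF \<phi>] in \<open>auto intro: has_field_derivative_at_within\<close>)
    also have "norm (x - a) \<le> (1 + \<bar>a\<bar>) * ?w"
    proof -
      have "2 * \<bar>x\<bar> \<le> 1 + x\<^sup>2" using sum_squares_bound[of 1 "\<bar>x\<bar>"] by simp
      then have "\<bar>x\<bar> \<le> ?w" by linarith
      moreover have "\<bar>a\<bar> * 1 \<le> \<bar>a\<bar> * ?w" by (intro mult_left_mono) auto
      ultimately have "\<bar>x - a\<bar> \<le> ?w + \<bar>a\<bar> * ?w" by linarith
      then show ?thesis by (simp only: distrib_right mult_1 real_norm_def)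
    qed
    finally have "\<bar>\<phi> x - \<phi> a\<bar> \<le> (C * ((1 + a\<^sup>2) * ?w) ^ k) * ((1 + \<bar>a\<bar>) * ?w)"
      using C(1) by (simp add: mult_left_mono)
    also have "\<dots> = A * ?w ^ Suc k" by (simp add: A_def power_mult_distrib mult_ac)
    finally have "\<bar>\<phi> x\<bar> \<le> \<bar>\<phi> a\<bar> + A * ?w ^ Suc k" by linarith
    also have "\<dots> \<le> (\<bar>\<phi> a\<bar> + A) * ?w ^ Suc k"
      using mult_left_mono[OF w[of "Suc k"], of "\<bar>\<phi> a\<bar>"] by (simp add: distrib_right)
    finally have "\<bar>\<phi> x\<bar>\<^sup>2 \<le> ((\<bar>\<phi> a\<bar> + A) * ?w ^ Suc k)\<^sup>2" by (rule power_mono) simp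
    then have "(\<phi> x)\<^sup>2 \<le> (\<bar>\<phi> a\<bar> + A)\<^sup>2 * ?w ^ (2 * Suc k)"
      by (simp only: power2_abs power_mult_distrib power_even_eq)
    then show ?thesis using w[of "2 * Suc k"] by (simp only: distrib_right mult_1)
  qed
  then show ?thesis by (intro exI[of _ "1 + (\<bar>\<phi> a\<bar> + A)\<^sup>2"] conjI exI[of _ "2 * Suc k"]) auto
qed

text \<open>By induction, the j-th derivatives of \<open>f n\<close> converge to that of
  \<open>F\<close> on \<open>U\<close>; uniform convergence of the next derivatives allows
  differentiation of this limit, which identifies their limit as well.\<close>

lemma nderiv_within_tendsto:
  assumes U: "open U" and f: "\<And>n. smooth_on UNIV (f n)" and F: "smooth_on UNIV F"
    and lim: "\<And>y. y \<in> U \<Longrightarrow> (\<lambda>n. f n y) \<longlonglongrightarrow> F y"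
    and Cauchy: "\<And>j. uniformly_Cauchy_on U (\<lambda>n. nderiv_within UNIV j (f n))"
    and y: "y \<in> U"
  shows "(\<lambda>n. nderiv_within UNIV j (f n) y) \<longlonglongrightarrow> nderiv_within UNIV j F y"
  using y
proof (induction j arbitrary: y)
  case 0
  then show ?case using lim by simp
next
  case (Suc j)
  obtain g where g: "uniform_limit U (\<lambda>n. nderiv_within UNIV (Suc j) (f n)) g sequentially"
    using Cauchy_uniformly_convergent[OF Cauchy[of "Suc j"]] by (auto simp: uniformly_convergent_on_def)
  obtain d where d: "d > 0" "ball y d \<subseteq> U" using U Suc.prems open_contains_ball by blast
  have "\<exists>G. \<forall>x\<in>ball y d. (\<lambda>n. nderiv_within UNIV j (f n) x) \<longlonglongrightarrow> G x \<and>
      (G has_derivative (*) (g x)) (at x within ball y d)"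
  proof (rule has_derivative_sequence)
    fix n x
    show "(nderiv_within UNIV j (f n) has_derivative (*) (nderiv_within UNIV (Suc j) (f n) x)) (at x within ball y d)"
      using DERIV_nderiv_within[OF f, of j n x] has_field_derivative_at_within
      unfolding has_field_derivative_def[symmetric] by blast
  next
    fix e :: real assume "e > 0"
    then have "\<forall>\<^sub>F n in sequentially. \<forall>x\<in>U. dist (nderiv_within UNIV (Suc j) (f n) x) (g x) < e"
      using g by (simp add: uniform_limit_iff)
    then show "\<forall>\<^sub>F n in sequentially. \<forall>x\<in>ball y d. \<forall>h.
        norm (nderiv_within UNIV (Suc j) (f n) x * h - g x * h) \<le> e * norm h"
    proof (rule eventually_mono, intro ballI allI)
      fix n x h assume *: "\<forall>x\<in>U. dist (nderiv_within UNIV (Suc j) (f n) x) (g x) < e" "x \<in> ball y d"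
      then have "\<bar>nderiv_within UNIV (Suc j) (f n) x - g x\<bar> \<le> e"
        using d(2) by (force simp: dist_real_def)
      then show "norm (nderiv_within UNIV (Suc j) (f n) x * h - g x * h) \<le> e * norm h"
        by (simp add: left_diff_distrib[symmetric] abs_mult mult_right_mono)
    qed
  next
    show "y \<in> ball y d" using d by simp
    show "(\<lambda>n. nderiv_within UNIV j (f n) y) \<longlonglongrightarrow> nderiv_within UNIV j F y"
      by (rule Suc.IH[OF Suc.prems])
  qed simp
  then obtain G where G: "\<And>x. x \<in> ball y d \<Longrightarrow> (\<lambda>n. nderiv_within UNIV j (f n) x) \<longlonglongrightarrow> G x"
      "\<And>x. x \<in> ball y d \<Longrightarrow> (G has_derivative (*) (g x)) (at x within ball y d)" by blast
  have eq: "G x = nderiv_within UNIV j F x" if "x \<in> ball y d" for x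
    using LIMSEQ_unique[OF G(1)[OF that] Suc.IH] that d(2) by blast
  have "(G has_real_derivative g y) (at y)"
    using G(2)[of y] d(1) at_within_open[of y "ball y d"] by (simp add: has_field_derivative_def)
  then have "(nderiv_within UNIV j F has_real_derivative g y) (at y)"
    by (rule has_field_derivative_transform_within_open[of _ _ _ "ball y d"]) (use d(1) eq in auto)
  then have "nderiv_within UNIV (Suc j) F y = g y"
    using DERIV_unique[OF DERIV_nderiv_within[OF F]] by blast
  then show ?case using tendsto_uniform_limitI[OF g Suc.prems] by simp
qed

section \<open>Composition operators\<close>

lemma schwartz_symbolD:
  assumes "schwartz_symbol \<phi>"
  shows "smooth_on UNIV \<phi>" and "schwartz_on UNIV f \<Longrightarrow> schwartz_on UNIV (f \<circ> \<phi>)"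
  using assms by (auto simp: schwartz_symbol_def Cinf_def schwartz_UNIV_iff)

text \<open>Composing with a bump equal to 1 on [-Y, Y] gives the value 1 wherever |\<phi> x| \<le>
  Y, and decay of the composition confines such \<open>x\<close> to a bounded set.\<close>

lemma schwartz_symbol_proper:
  assumes "schwartz_symbol \<phi>"
  shows "\<exists>R. \<forall>x. R < \<bar>x\<bar> \<longrightarrow> Y < \<bar>\<phi> x\<bar>"
proof -
  obtain b where b: "schwartz_on UNIV b" "\<And>x. x \<in> {-Y..Y} \<Longrightarrow> b x = 1"
    using ex_schwartz_bump by blast
  obtain B where B: "\<And>x j. j \<le> 1 \<Longrightarrow> (1 + x\<^sup>2) ^ 1 * \<bar>nderiv_within UNIV j (b \<circ> \<phi>) x\<bar> \<le> B"
    using schwartz_onD(2)[OF schwartz_symbolD(2)[OF assms b(1)], of 1] by blast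
  have "Y < \<bar>\<phi> x\<bar>" if "\<bar>B\<bar> + 1 < \<bar>x\<bar>" for x
  proof (rule ccontr)
    assume "\<not> Y < \<bar>\<phi> x\<bar>"
    then have "b (\<phi> x) = 1" by (intro b(2)) auto
    then have "1 + x\<^sup>2 \<le> B" using B[of 0 x] by simp
    moreover have "\<bar>x\<bar> * 1 \<le> \<bar>x\<bar> * \<bar>x\<bar>" using that by (intro mult_left_mono) auto
    ultimately show False using that by (simp add: power2_eq_square)
  qed
  then show ?thesis by blast
qed

text \<open>A range that is an interval unbounded on both sides is the whole line. The sign
  \<open>s\<close> treats lower and upper bounds together.\<close>

lemma not_surj_imp_one_sided:
  assumes "continuous_on UNIV \<phi>" "\<not> surj (\<phi> :: real \<Rightarrow> real)"
  shows "\<exists>s m. (s = 1 \<or> s = -1) \<and> (\<forall>x. m \<le> s * \<phi> x)"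
proof (rule ccontr)
  assume neg: "\<not> ?thesis"
  have iv: "is_interval (range \<phi>)"
    using connected_continuous_image[OF assms(1)] by (simp add: is_interval_connected_1)
  have "y \<in> range \<phi>" for y
  proof -
    obtain x1 where "\<phi> x1 < y" using neg by (metis mult_1 not_le)
    moreover obtain x2 where "-1 * \<phi> x2 < - y" using neg by (metis not_le)
    ultimately show ?thesis
      by (auto intro: mem_is_interval_1_I[OF iv rangeI[of _ x1] rangeI[of _ x2]])
  qed
  then show False using assms(2) by blast
qed

section \<open>Estimates for a fixed symbol and interval\<close>

context
  fixes \<phi> :: "real \<Rightarrow> real" and I :: "real set"
  assumes symbol: "schwartz_symbol \<phi>"
    and I: "closed_unbounded_interval I"
    and mult: "\<And>f. schwartz_on I f \<Longrightarrow> schwartz_on I (\<lambda>x. deriv \<phi> x * f x)"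
    and closed: "closedin (schwartz_topology I) (mult_op I (deriv \<phi>) ` schwartz I)"
begin

text \<open>By the chain rule, (f o \<phi>)' is \<open>deriv \<phi>\<close> times f' o \<phi>, so
  \<open>division_estimate\<close> applies. The bound \<open>B\<close> stands in for a seminorm so
  that hypothesis and conclusion both concern regular points only and the step can be
  iterated.\<close>

lemma regular_estimate_step:
  "\<exists>C\<ge>0. \<exists>k. \<forall>f B. schwartz_on UNIV f \<longrightarrow> 0 \<le> B \<longrightarrow>
     (\<forall>x\<in>I. deriv \<phi> x \<noteq> 0 \<longrightarrow> (\<forall>i\<le>k. (1 + x\<^sup>2) ^ k * \<bar>nderiv_within UNIV i (f \<circ> \<phi>) x\<bar> \<le> B)) \<longrightarrow>
     (\<forall>x\<in>I. deriv \<phi> x \<noteq> 0 \<longrightarrow> (\<forall>j\<le>m.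
        (1 + x\<^sup>2) ^ m * \<bar>nderiv_within UNIV j (nderiv_within UNIV 1 f \<circ> \<phi>) x\<bar> \<le> C * B))"
proof -
  note \<phi> = schwartz_symbolD(1)[OF symbol]
  obtain C k where C: "C \<ge> 0" "\<And>v x j. schwartz_on I v \<Longrightarrow> x \<in> I \<Longrightarrow> deriv \<phi> x \<noteq> 0 \<Longrightarrow> j \<le> m \<Longrightarrow>
     (1 + x\<^sup>2) ^ m * \<bar>nderiv_within I j v x\<bar> \<le> C * schwartz_seminorm I k (\<lambda>x. deriv \<phi> x * v x)"
    using division_estimate[OF I smooth_on_restriction[OF I smooth_on_deriv[OF \<phi>]] mult closed, of m] by metis
  \<comment> \<open>\<open>Suc k\<close> instead of \<open>k\<close> because the i-th derivative of
    \<open>u\<close> is derivative number i + 1 of the composition.\<close>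
  have "(1 + x\<^sup>2) ^ m * \<bar>nderiv_within UNIV j (nderiv_within UNIV 1 f \<circ> \<phi>) x\<bar> \<le> C * B"
    if f: "schwartz_on UNIV f" and B: "0 \<le> B"
      and bound: "\<forall>x\<in>I. deriv \<phi> x \<noteq> 0 \<longrightarrow>
         (\<forall>i\<le>Suc k. (1 + x\<^sup>2) ^ Suc k * \<bar>nderiv_within UNIV i (f \<circ> \<phi>) x\<bar> \<le> B)"
      and x: "x \<in> I" "deriv \<phi> x \<noteq> 0" "j \<le> m" for f B x j
  proof -
    define v where "v = nderiv_within UNIV 1 f \<circ> \<phi>"
    define u where "u = nderiv_within UNIV 1 (f \<circ> \<phi>)"
    have v: "schwartz_on UNIV v" and u: "schwartz_on UNIV u"
      unfolding v_def u_def by (intro schwartz_symbolD(2)[OF symbol] schwartz_on_nderiv_within f)+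
    have u_eq: "u = (\<lambda>x. deriv \<phi> x * v x)"
      unfolding u_def v_def using nderiv_within_1_comp[OF schwartz_onD(1)[OF f] \<phi>] by auto
    have uI: "schwartz_on I u" by (rule schwartz_on_restriction[OF I u])
    define W where "W = {x \<in> I. deriv \<phi> x \<noteq> 0}"
    have "(1 + y\<^sup>2) ^ k * \<bar>nderiv_within I i u y\<bar> \<le> B" if y: "y \<in> I" "i \<le> k" for y i
    proof (cases "y \<in> closure W")
      case True
      have "closed {z. (1 + z\<^sup>2) ^ k * \<bar>nderiv_within UNIV i u z\<bar> \<le> B}"
        using continuous_on_nderiv_within[OF schwartz_onD(1)[OF u], of i]
        by (intro closed_Collect_le continuous_intros)
      moreover have "W \<subseteq> {z. (1 + z\<^sup>2) ^ k * \<bar>nderiv_within UNIV i u z\<bar> \<le> B}"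
      proof safe
        fix z assume "z \<in> W"
        then have "(1 + z\<^sup>2) ^ Suc k * \<bar>nderiv_within UNIV (Suc i) (f \<circ> \<phi>) z\<bar> \<le> B"
          using bound y(2) by (auto simp: W_def)
        moreover have "(1 + z\<^sup>2) ^ k * \<bar>nderiv_within UNIV (Suc i) (f \<circ> \<phi>) z\<bar>
            \<le> (1 + z\<^sup>2) ^ Suc k * \<bar>nderiv_within UNIV (Suc i) (f \<circ> \<phi>) z\<bar>"
          by (intro mult_right_mono power_increasing) auto
        ultimately show "(1 + z\<^sup>2) ^ k * \<bar>nderiv_within UNIV i u z\<bar> \<le> B"
          by (simp add: u_def nderiv_within_nderiv_within)
      qed
      ultimately have "closure W \<subseteq> {z. (1 + z\<^sup>2) ^ k * \<bar>nderiv_within UNIV i u z\<bar> \<le> B}"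
        by (rule closure_minimal[rotated])
      then show ?thesis
        using True nderiv_within_restriction[OF I schwartz_onD(1)[OF u] y(1)] by auto
    next
      case False
      \<comment> \<open>Outside the closure of \<open>W\<close> the factor
        \<open>deriv \<phi>\<close> vanishes on a relatively open part of \<open>I\<close>, so
        \<open>u\<close> has zero derivatives of every order there.\<close>
      have "deriv \<phi> z = 0" if "z \<in> - closure W \<inter> I" for z
        using that closure_subset[of W] by (auto simp: W_def)
      then have "nderiv_within I i u y = 0"
        using False y(1)
        by (intro nderiv_within_eq_zero[OF I schwartz_onD(1)[OF uI], of "- closure W"]) (auto simp: u_eq)
      then show ?thesis using B by simp
    qed
    then have "schwartz_seminorm I k u \<le> B"
      unfolding schwartz_seminorm_le_iff[OF I uI] by blast
    then have "C * schwartz_seminorm I k u \<le> C * B" using C(1) by (rule mult_left_mono)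
    then show ?thesis
      using C(2)[OF schwartz_on_restriction[OF I v] x] nderiv_within_restriction[OF I schwartz_onD(1)[OF v] x(1)]
      unfolding u_eq v_def by simp
  qed
  then show ?thesis using C(1) by (intro exI[of _ C] conjI exI[of _ "Suc k"]) auto
qed

text \<open>Each step replaces \<open>f\<close> by its derivative and asks for a stronger weight
  \<open>k\<close> in place of \<open>m\<close>; the induction on \<open>j\<close> therefore keeps
  \<open>m\<close> arbitrary.\<close>

lemma regular_estimate:
  "\<exists>C\<ge>0. \<exists>k. \<forall>f. schwartz_on UNIV f \<longrightarrow> (\<forall>x\<in>I. deriv \<phi> x \<noteq> 0 \<longrightarrow> (\<forall>i\<le>m.
     (1 + x\<^sup>2) ^ m * \<bar>nderiv_within UNIV i (nderiv_within UNIV j f \<circ> \<phi>) x\<bar>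
       \<le> C * schwartz_seminorm UNIV k (f \<circ> \<phi>)))"
proof (induction j arbitrary: m)
  case 0
  show ?case
    using schwartz_seminorm_ge[OF closed_unbounded_interval_UNIV schwartz_symbolD(2)[OF symbol]]
    by (intro exI[of _ "1::real"] conjI exI[of _ m]) (auto simp: o_def)
next
  case (Suc j)
  obtain C k where C: "C \<ge> 0" and step: "\<And>f B. schwartz_on UNIV f \<Longrightarrow> 0 \<le> B \<Longrightarrow>
     (\<forall>x\<in>I. deriv \<phi> x \<noteq> 0 \<longrightarrow> (\<forall>i\<le>k. (1 + x\<^sup>2) ^ k * \<bar>nderiv_within UNIV i (f \<circ> \<phi>) x\<bar> \<le> B)) \<Longrightarrow>
     (\<forall>x\<in>I. deriv \<phi> x \<noteq> 0 \<longrightarrow> (\<forall>j\<le>m.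
        (1 + x\<^sup>2) ^ m * \<bar>nderiv_within UNIV j (nderiv_within UNIV 1 f \<circ> \<phi>) x\<bar> \<le> C * B))"
    using regular_estimate_step[of m] by blast
  obtain C' k' where C': "C' \<ge> 0" and IH: "\<And>f. schwartz_on UNIV f \<Longrightarrow>
     (\<forall>x\<in>I. deriv \<phi> x \<noteq> 0 \<longrightarrow> (\<forall>i\<le>k. (1 + x\<^sup>2) ^ k *
       \<bar>nderiv_within UNIV i (nderiv_within UNIV j f \<circ> \<phi>) x\<bar> \<le> C' * schwartz_seminorm UNIV k' (f \<circ> \<phi>)))"
    using Suc.IH[of k] by blast
  have "\<forall>x\<in>I. deriv \<phi> x \<noteq> 0 \<longrightarrow> (\<forall>i\<le>m.
     (1 + x\<^sup>2) ^ m * \<bar>nderiv_within UNIV i (nderiv_within UNIV (Suc j) f \<circ> \<phi>) x\<bar>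
       \<le> (C * C') * schwartz_seminorm UNIV k' (f \<circ> \<phi>))" if f: "schwartz_on UNIV f" for f
    using step[OF schwartz_on_nderiv_within[OF f] _ IH[OF f]] C'
      schwartz_seminorm_nonneg[OF closed_unbounded_interval_UNIV schwartz_symbolD(2)[OF symbol f]]
    by (simp add: nderiv_within_nderiv_within mult.assoc)
  moreover have "0 \<le> C * C'" using C C' by simp
  ultimately show ?case by blast
qed

text \<open>Polynomial growth of \<phi> converts the weight \<open>p * m\<close> at \<open>x\<close>
  into the weight \<open>m\<close> at \<phi> x. Interior points have values of \<phi> on both sides
  at every small distance, so they are limits of regular images, and continuity of the derivatives
  of \<open>f\<close> does the rest.\<close>

lemma target_estimate:
  "\<exists>C\<ge>0. \<exists>k. \<forall>f. schwartz_on UNIV f \<longrightarrow> (\<forall>y\<in>interior (\<phi> ` I).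
     (1 + y\<^sup>2) ^ m * \<bar>nderiv_within UNIV j f y\<bar> \<le> C * schwartz_seminorm UNIV k (f \<circ> \<phi>))"
proof -
  note \<phi> = schwartz_symbolD(1)[OF symbol]
  note conv = closed_unbounded_interval_imp_convex[OF I]
  obtain a where a: "a \<in> I" using closed_unbounded_interval_nonempty[OF I] by blast
  obtain C0 k0 where "C0 \<ge> 0" "\<And>x. x \<in> I \<Longrightarrow> \<bar>deriv \<phi> x\<bar> \<le> C0 * (1 + x\<^sup>2) ^ k0"
    using multiplier_growth[OF I mult] by blast
  then obtain K p where K: "K \<ge> 0" "\<And>x. x \<in> I \<Longrightarrow> 1 + (\<phi> x)\<^sup>2 \<le> K * (1 + x\<^sup>2) ^ p"
    using polynomially_bounded_if_deriv[OF conv a \<phi>] by metis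
  obtain C k where C: "C \<ge> 0" "\<And>f x. schwartz_on UNIV f \<Longrightarrow> x \<in> I \<Longrightarrow> deriv \<phi> x \<noteq> 0 \<Longrightarrow>
     (1 + x\<^sup>2) ^ (p * m) * \<bar>nderiv_within UNIV j f (\<phi> x)\<bar> \<le> C * schwartz_seminorm UNIV k (f \<circ> \<phi>)"
    using regular_estimate[of "p * m" j] by fastforce
  define W where "W = {x \<in> I. deriv \<phi> x \<noteq> 0}"
  have "(1 + y\<^sup>2) ^ m * \<bar>nderiv_within UNIV j f y\<bar> \<le> (K ^ m * C) * schwartz_seminorm UNIV k (f \<circ> \<phi>)"
    if f: "schwartz_on UNIV f" and y: "y \<in> interior (\<phi> ` I)" for f y
  proof -
    let ?B = "(K ^ m * C) * schwartz_seminorm UNIV k (f \<circ> \<phi>)"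
    let ?T = "{z. (1 + z\<^sup>2) ^ m * \<bar>nderiv_within UNIV j f z\<bar> \<le> ?B}"
    have "closed ?T"
      using continuous_on_nderiv_within[OF schwartz_onD(1)[OF f], of j]
      by (intro closed_Collect_le continuous_intros)
    moreover have "\<phi> ` W \<subseteq> ?T"
    proof safe
      fix x assume "x \<in> W"
      then have x: "x \<in> I" "deriv \<phi> x \<noteq> 0" by (auto simp: W_def)
      have "(1 + (\<phi> x)\<^sup>2) ^ m \<le> (K * (1 + x\<^sup>2) ^ p) ^ m"
        using K(2)[OF x(1)] by (intro power_mono) auto
      then have "(1 + (\<phi> x)\<^sup>2) ^ m * \<bar>nderiv_within UNIV j f (\<phi> x)\<bar>
          \<le> K ^ m * ((1 + x\<^sup>2) ^ (p * m) * \<bar>nderiv_within UNIV j f (\<phi> x)\<bar>)"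
        by (simp add: power_mult_distrib power_mult mult_right_mono flip: mult.assoc)
      also have "\<dots> \<le> K ^ m * (C * schwartz_seminorm UNIV k (f \<circ> \<phi>))"
        using C(2)[OF f x] K(1) by (intro mult_left_mono) auto
      finally show "(1 + (\<phi> x)\<^sup>2) ^ m * \<bar>nderiv_within UNIV j f (\<phi> x)\<bar> \<le> ?B" by simp
    qed
    ultimately have "closure (\<phi> ` W) \<subseteq> ?T" by (rule closure_minimal[rotated])
    moreover have "y \<in> closure (\<phi> ` W)"
    proof (rule closure_approachable[THEN iffD2], intro allI impI)
      fix e :: real assume "e > 0"
      obtain d where d: "d > 0" "ball y d \<subseteq> \<phi> ` I" using y mem_interior by blast
      define r where "r = min e d / 2"
      have r: "r > 0" "r < e" "r < d" using \<open>e > 0\<close> d(1) by (auto simp: r_def)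
      have "y - r \<in> \<phi> ` I" "y + r \<in> \<phi> ` I" using r d(2) by (auto simp: subset_iff dist_real_def)
      then obtain x where "x \<in> W" "y - r < \<phi> x" "\<phi> x < y + r"
        using regular_values_dense[OF conv \<phi>, of "y - r" "y + r"] r(1) by (auto simp: W_def)
      then show "\<exists>z\<in>\<phi> ` W. dist z y < e" using r(2) by (intro bexI[of _ "\<phi> x"]) (auto simp: dist_real_def)
    qed
    ultimately show ?thesis by blast
  qed
  moreover have "K ^ m * C \<ge> 0" using K(1) C(1) by simp
  ultimately show ?thesis by blast
qed

text \<open>The preceding estimate, applied to \<open>f n\<close> and to the differences \<open>f n - f l\<close>, makes the
  \<open>f n\<close> converge together with all derivatives.\<close>

lemma limit_decay:
  assumes f: "\<And>n. schwartz_on UNIV (f n)" and F: "smooth_on UNIV F" and g: "schwartz_on UNIV (F \<circ> \<phi>)"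
    and lim: "\<And>k. (\<lambda>n. schwartz_seminorm UNIV k (\<lambda>x. (f n \<circ> \<phi>) x - (F \<circ> \<phi>) x)) \<longlonglongrightarrow> 0"
  shows "\<exists>B. \<forall>y\<in>interior (\<phi> ` I). (1 + y\<^sup>2) ^ m * \<bar>nderiv_within UNIV j F y\<bar> \<le> B"
proof -
  note U = closed_unbounded_interval_UNIV
  note comp = schwartz_symbolD(2)[OF symbol]
  let ?e = "\<lambda>k n. schwartz_seminorm UNIV k (\<lambda>x. (f n \<circ> \<phi>) x - (F \<circ> \<phi>) x)"
  have cauchy: "uniformly_Cauchy_on (interior (\<phi> ` I)) (\<lambda>n. nderiv_within UNIV j (f n))" for j
  proof (rule uniformly_Cauchy_onI)
    fix e :: real assume e: "e > 0"
    obtain C k where C: "C \<ge> 0" "\<And>f y. schwartz_on UNIV f \<Longrightarrow> y \<in> interior (\<phi> ` I) \<Longrightarrow>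
       (1 + y\<^sup>2) ^ 0 * \<bar>nderiv_within UNIV j f y\<bar> \<le> C * schwartz_seminorm UNIV k (f \<circ> \<phi>)"
      using target_estimate[of 0 j] by metis
    have "(\<lambda>n. C * ?e k n) \<longlonglongrightarrow> 0" using lim by (rule tendsto_mult_right_zero)
    then have "\<forall>\<^sub>F n in sequentially. C * ?e k n < e / 2" by (rule order_tendstoD) (use e in simp)
    then obtain N where N: "\<And>n. n \<ge> N \<Longrightarrow> C * ?e k n < e / 2" by (auto simp: eventually_sequentially)
    have "dist (nderiv_within UNIV j (f n) y) (nderiv_within UNIV j (f l) y) < e"
      if nl: "n \<ge> N" "l \<ge> N" and y: "y \<in> interior (\<phi> ` I)" for n l y
    proof -
      have "\<bar>nderiv_within UNIV j (f n) y - nderiv_within UNIV j (f l) y\<bar>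
          \<le> C * schwartz_seminorm UNIV k ((\<lambda>x. f n x - f l x) \<circ> \<phi>)"
        using C(2)[OF schwartz_on_diff[OF U f f] y] nderiv_within_diff[OF U schwartz_onD(1)[OF f] schwartz_onD(1)[OF f]]
        by simp
      also have "schwartz_seminorm UNIV k ((\<lambda>x. f n x - f l x) \<circ> \<phi>) \<le> ?e k n + ?e k l"
        using schwartz_seminorm_triangle[OF U comp[OF f] g comp[OF f], of k n l]
          schwartz_seminorm_minus_commute[OF U g comp[OF f], of k l]
        by (simp add: o_def)
      finally show ?thesis
        using C(1) N[OF nl(1)] N[OF nl(2)] by (simp add: dist_real_def distrib_left mult_left_mono)
    qed
    then show "\<exists>M. \<forall>y\<in>interior (\<phi> ` I). \<forall>n\<ge>M. \<forall>l\<ge>M.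
        dist (nderiv_within UNIV j (f n) y) (nderiv_within UNIV j (f l) y) < e" by blast
  qed
  have ptw: "(\<lambda>n. f n y) \<longlonglongrightarrow> F y" if yI: "y \<in> interior (\<phi> ` I)" for y
  proof -
    obtain x where x: "y = \<phi> x" using interior_subset[of "\<phi> ` I"] yI by blast
    have "(\<lambda>n. f n (\<phi> x) - F (\<phi> x)) \<longlonglongrightarrow> 0"
    proof (rule Lim_null_comparison[OF _ lim[of 0]])
      show "\<forall>\<^sub>F n in sequentially. norm (f n (\<phi> x) - F (\<phi> x)) \<le> ?e 0 n"
        using nderiv_within_le_schwartz_seminorm[OF U schwartz_on_diff[OF U comp[OF f] g], of x 0 0]
        by (auto intro!: always_eventually)
    qed
    then show ?thesis using x by (simp add: LIM_zero_iff)
  qed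
  obtain C k where C: "C \<ge> 0" "\<And>f y. schwartz_on UNIV f \<Longrightarrow> y \<in> interior (\<phi> ` I) \<Longrightarrow>
     (1 + y\<^sup>2) ^ m * \<bar>nderiv_within UNIV j f y\<bar> \<le> C * schwartz_seminorm UNIV k (f \<circ> \<phi>)"
    using target_estimate[of m j] by metis
  \<comment> \<open>The seminorms of \<open>f n \<circ> \<phi>\<close> eventually exceed that of the
    limit by less than 1.\<close>
  define B where "B = C * (1 + schwartz_seminorm UNIV k (F \<circ> \<phi>))"
  have ev: "\<forall>\<^sub>F n in sequentially. ?e k n < 1" using lim by (rule order_tendstoD) simp
  have "(1 + y\<^sup>2) ^ m * \<bar>nderiv_within UNIV j F y\<bar> \<le> B" if y: "y \<in> interior (\<phi> ` I)" for y
  proof (rule tendsto_upperbound)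
    show "(\<lambda>n. (1 + y\<^sup>2) ^ m * \<bar>nderiv_within UNIV j (f n) y\<bar>) \<longlonglongrightarrow> (1 + y\<^sup>2) ^ m * \<bar>nderiv_within UNIV j F y\<bar>"
      by (intro tendsto_intros nderiv_within_tendsto[OF open_interior schwartz_onD(1)[OF f] F ptw cauchy y])
    show "\<forall>\<^sub>F n in sequentially. (1 + y\<^sup>2) ^ m * \<bar>nderiv_within UNIV j (f n) y\<bar> \<le> B"
      using ev
    proof (rule eventually_mono)
      fix n assume n: "?e k n < 1"
      have "schwartz_seminorm UNIV k (f n \<circ> \<phi>) \<le> ?e k n + schwartz_seminorm UNIV k (F \<circ> \<phi>)"
        using schwartz_seminorm_add[OF U schwartz_on_diff[OF U comp[OF f] g] g, of k n] by (simp add: o_def)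
      then have "C * schwartz_seminorm UNIV k (f n \<circ> \<phi>) \<le> B"
        unfolding B_def using n C(1) by (intro mult_left_mono) auto
      then show "(1 + y\<^sup>2) ^ m * \<bar>nderiv_within UNIV j (f n) y\<bar> \<le> B"
        using C(2)[OF f y, of n] by linarith
    qed
  qed simp
  then show ?thesis by blast
qed

text \<open>The preimage \<open>F\<close> given by the closed range among smooth functions has
  controlled decay only at the end of the line that \<phi>(I) reaches; towards the other end it is
  cut off outside the range of \<phi>, which leaves the composition unchanged.\<close>

lemma closed_range_comp_op:
  assumes nsurj: "\<not> surj \<phi>" and Cinf_closed: "closedin Cinf_topology (comp_op \<phi> ` Cinf)"
  shows "closedin (schwartz_topology UNIV) (comp_op \<phi> ` schwartz UNIV)"
proof (rule closedin_schwartz_topologyI)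
  note U = closed_unbounded_interval_UNIV
  note \<phi> = schwartz_symbolD(1)[OF symbol]
  note comp = schwartz_symbolD(2)[OF symbol]
  have cont: "continuous_on A \<phi>" for A
    using continuous_on_nderiv_within[OF \<phi>, of 0] continuous_on_subset by auto
  show "closed_unbounded_interval UNIV" by (rule U)
  show "comp_op \<phi> ` schwartz UNIV \<subseteq> schwartz UNIV"
    using comp by (auto simp: comp_op_def schwartz_UNIV_iff)
  fix g assume "g \<in> schwartz UNIV" and approx: "\<And>k e. e > 0 \<Longrightarrow>
      \<exists>a\<in>comp_op \<phi> ` schwartz UNIV. schwartz_seminorm UNIV k (\<lambda>x. a x - g x) < e"
  then have g: "schwartz_on UNIV g" by (simp add: schwartz_UNIV_iff)
  \<comment> \<open>A diagonal choice, with the seminorm index and the accuracy both tied to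
    \<open>n\<close>; as seminorms increase with their index, one sequence converges in all of
    them.\<close>
  have "\<exists>f. schwartz_on UNIV f \<and> schwartz_seminorm UNIV n (\<lambda>x. (f \<circ> \<phi>) x - g x) < inverse (real (Suc n))" for n
    using approx[of "inverse (real (Suc n))" n] by (auto simp: comp_op_def schwartz_UNIV_iff)
  then obtain f where f: "\<And>n. schwartz_on UNIV (f n)"
      "\<And>n. schwartz_seminorm UNIV n (\<lambda>x. (f n \<circ> \<phi>) x - g x) < inverse (real (Suc n))" by metis
  have "g \<in> comp_op \<phi> ` Cinf"
  proof (rule closedin_Cinf_topologyD[OF Cinf_closed g])
    fix k and e :: real assume "e > 0"
    then obtain h where "schwartz_on UNIV h" "schwartz_seminorm UNIV k (\<lambda>x. (h \<circ> \<phi>) x - g x) < e"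
      using approx[of e k] by (auto simp: comp_op_def schwartz_UNIV_iff)
    then show "\<exists>a\<in>comp_op \<phi> ` Cinf. schwartz_on UNIV a \<and> schwartz_seminorm UNIV k (\<lambda>x. a x - g x) < e"
      using comp by (intro bexI[of _ "h \<circ> \<phi>"]) (auto simp: comp_op_def Cinf_def schwartz_onD)
  qed
  then obtain F where F: "smooth_on UNIV F" "g = F \<circ> \<phi>" by (auto simp: comp_op_def Cinf_def)
  have lim: "(\<lambda>n. schwartz_seminorm UNIV k (\<lambda>x. (f n \<circ> \<phi>) x - (F \<circ> \<phi>) x)) \<longlonglongrightarrow> 0" for k
  proof (rule tendsto_sandwich[OF _ _ tendsto_const LIMSEQ_inverse_real_of_nat])
    have d: "schwartz_on UNIV (\<lambda>x. (f n \<circ> \<phi>) x - (F \<circ> \<phi>) x)" for n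
      using schwartz_on_diff[OF U comp[OF f(1)] g] F(2) by simp
    show "\<forall>\<^sub>F n in sequentially. 0 \<le> schwartz_seminorm UNIV k (\<lambda>x. (f n \<circ> \<phi>) x - (F \<circ> \<phi>) x)"
      using schwartz_seminorm_nonneg[OF U d] by simp
    show "\<forall>\<^sub>F n in sequentially. schwartz_seminorm UNIV k (\<lambda>x. (f n \<circ> \<phi>) x - (F \<circ> \<phi>) x) \<le> inverse (real (Suc n))"
      using eventually_ge_at_top[of k]
    proof (rule eventually_mono)
      fix n assume "k \<le> n"
      then show "schwartz_seminorm UNIV k (\<lambda>x. (f n \<circ> \<phi>) x - (F \<circ> \<phi>) x) \<le> inverse (real (Suc n))"
        using schwartz_seminorm_mono[OF U d, of k n n] f(2)[of n] F(2) by simp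
    qed
  qed
  note decay = limit_decay[OF f(1) F(1) g[unfolded F(2)] lim]
  obtain s m where s: "s = 1 \<or> s = -1" and m: "\<And>x. m \<le> s * \<phi> x"
    using not_surj_imp_one_sided[OF cont nsurj] by blast
  have s_abs: "\<bar>s * y\<bar> = \<bar>y\<bar>" for y using s by auto
  obtain a where a: "a \<in> I" using closed_unbounded_interval_nonempty[OF I] by blast
  \<comment> \<open>Properness gives a point \<open>x\<close> of \<open>I\<close> with |\<phi> x|
    beyond |y| + |m|. The bound \<open>m\<close> excludes the wrong sign, so \<open>y\<close> lies
    between \<phi> a and \<phi> x, and \<phi>(I) is an interval.\<close>
  have image: "y \<in> \<phi> ` I" if "s * \<phi> a < s * y" for y
  proof -
    obtain R where R: "\<And>x. R < \<bar>x\<bar> \<Longrightarrow> \<bar>y\<bar> + \<bar>m\<bar> < \<bar>\<phi> x\<bar>" using schwartz_symbol_proper[OF symbol] by blast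
    obtain x where x: "x \<in> I" "R < \<bar>x\<bar>"
      using I unfolding closed_unbounded_interval_def bounded_iff by (metis not_le real_norm_def)
    then have "s * y < s * \<phi> x" using R[OF x(2)] m[of x] s by auto
    moreover have "is_interval (\<phi> ` I)"
      using connected_continuous_image[OF cont] I
      by (simp add: is_interval_connected_1 closed_unbounded_interval_def)
    ultimately show ?thesis
      using s mem_is_interval_1_I[of "\<phi> ` I" "\<phi> a" "\<phi> x" y] mem_is_interval_1_I[of "\<phi> ` I" "\<phi> x" "\<phi> a" y]
        that a x(1) by auto
  qed
  \<comment> \<open>The maximum serves two purposes: beyond \<open>s * \<phi> a\<close> points lie
    in \<phi>(I), and beyond \<open>m\<close> the cutoff below equals 1.\<close>
  define V where "V = {y. max m (s * \<phi> a) < s * y}"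
  have V: "open V" unfolding V_def by (intro open_Collect_less continuous_intros)
  have V_int: "V \<subseteq> interior (\<phi> ` I)"
    by (rule interior_maximal[OF _ V]) (use image in \<open>auto simp: V_def\<close>)
  obtain G where G: "smooth_on UNIV G" "\<And>x. x \<le> 0 \<Longrightarrow> G x = (0::real)" "\<And>x. x \<ge> 1 \<Longrightarrow> G x = 1"
    using ex_smooth_step by blast
  \<comment> \<open>The cutoff is 1 for s y \<ge> m, hence on the whole range of \<phi>, and 0 for s
    y \<le> m - 1.\<close>
  define h where "h y = G (s * y + (1 - m)) * F y" for y
  have h: "smooth_on UNIV h" unfolding h_def by (intro smooth_on_mult U smooth_on_affine G F)
  have "schwartz_on UNIV h"
  proof (rule schwartz_onI_infinity[OF h])
    fix n j
    obtain B where B: "\<And>y. y \<in> interior (\<phi> ` I) \<Longrightarrow> (1 + y\<^sup>2) ^ n * \<bar>nderiv_within UNIV j F y\<bar> \<le> B"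
      using decay by metis
    have "(1 + y\<^sup>2) ^ n * \<bar>nderiv_within UNIV j h y\<bar> \<le> max 0 B" if y: "\<bar>m\<bar> + \<bar>\<phi> a\<bar> + 1 < \<bar>y\<bar>" for y
    proof -
      have "\<bar>m\<bar> + \<bar>s * \<phi> a\<bar> + 1 < \<bar>s * y\<bar>" using y s_abs by simp
      \<comment> \<open>Far from the origin only the two ends of the line remain: \<open>V\<close>,
        where \<open>F\<close> decays, and the opposite end, where the cutoff vanishes.\<close>
      then consider "y \<in> V" | "s * y < m - 1" unfolding V_def by force
      then show ?thesis
      proof cases
        case 1
        have "nderiv_within UNIV j h y = nderiv_within UNIV j F y"
          by (rule nderiv_within_local[OF U h F(1) V]) (use 1 G(3) in \<open>auto simp: h_def V_def\<close>)
        then show ?thesis using B[of y] 1 V_int by (simp add: le_max_iff_disj subset_iff)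
      next
        case 2
        have "open {y. s * y < m - 1}" by (intro open_Collect_less continuous_intros)
        then have "nderiv_within UNIV j h y = 0"
          by (rule nderiv_within_eq_zero[OF U h]) (use 2 G(2) in \<open>auto simp: h_def\<close>)
        then show ?thesis by simp
      qed
    qed
    then show "\<exists>B R. \<forall>y. R < \<bar>y\<bar> \<longrightarrow> (1 + y\<^sup>2) ^ n * \<bar>nderiv_within UNIV j h y\<bar> \<le> B" by blast
  qed
  moreover have "g = comp_op \<phi> h"
    using m G(3) by (auto simp: comp_op_def F(2) h_def fun_eq_iff)
  ultimately show "g \<in> comp_op \<phi> ` schwartz UNIV" by (auto simp: schwartz_UNIV_iff)
qed

end

theorem theorem4p6:
  fixes \<phi> :: "real \<Rightarrow> real"
  assumes "schwartz_symbol \<phi>"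
    and "\<not> surj \<phi>"
    and "closedin Cinf_topology (comp_op \<phi> ` Cinf)"
    and "\<exists>I. closed_unbounded_interval I \<and>
           (\<forall>f\<in>schwartz I. mult_op I (deriv \<phi>) f \<in> schwartz I) \<and>
           closedin (schwartz_topology I) (mult_op I (deriv \<phi>) ` schwartz I)"
  shows "closedin (schwartz_topology UNIV) (comp_op \<phi> ` schwartz UNIV)"
proof -
  obtain I where I: "closed_unbounded_interval I"
    and mult: "\<And>f. f \<in> schwartz I \<Longrightarrow> mult_op I (deriv \<phi>) f \<in> schwartz I"
    and closed: "closedin (schwartz_topology I) (mult_op I (deriv \<phi>) ` schwartz I)"
    using assms(4) by blast
  have "schwartz_on I (\<lambda>x. deriv \<phi> x * f x)" if "schwartz_on I f" for f
  proof -
    have "mult_op I (deriv \<phi>) (restrict f I) = restrict (\<lambda>x. deriv \<phi> x * f x) I"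
      by (auto simp: mult_op_def fun_eq_iff)
    then show ?thesis
      using mult[of "restrict f I"] that by (simp add: restrict_in_schwartz_iff[OF I])
  qed
  then show ?thesis by (rule closed_range_comp_op[OF assms(1) I _ closed assms(2,3)])
qed

end
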